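(* Let $k\ge 0$ and $d\ge1$ be integers, and let $\mathcal C_{k,d}(n)$ be the set of level-$k$ $d$-colour contour algebra diagrams with $2n$ vertices in total ($n$ northern and $n$ southern). Then the array $Y_{TL,(d^k,1)}$ of level-$k$ $d$-colour half-diagrams is equivalent to the path array of the rooted graph $(\mathcal A(d^k,1),0)$, i.e. it is a Pascal $(\mathcal A(d^k,1),0)$-array, and it underlies the sequence $(\mathcal C_{k,d}(n))_{n\in\mathbb N}$.
   Context: $\mathbb N=\{0,1,2,\dots\}$. $\mathcal A(d^k,1)$ is the undirected rooted tree whose vertices are the finite sequences $(d_1,\dots,d_j)$, $j\ge0$, with $1\le d_i\le d$ for $i\le k$ and $d_i=1$ for $i>k$; the root $0$ is the empty sequence, and there is an (undirected) edge between $(d_1,\dots,d_{j})$ and $(d_1,\dots,d_{j},d_{j+1})$ for each such pair. An undirected edge is regarded as two opposite directed edges. For a rooted graph $(G,v_0)$ with vertices $V$, directed edges $E$, and initial/final maps $i,f:E\to V$, a Pascal $(G,v_0)$-array (= array equivalent to the path array $Y_{G,v_0}$) is a family of sets $Y(n;v)$, $n\in\mathbb N$, $v\in V$, with $Y(0;v_0)$ a singleton and $Y(0;v)=\emptyset$ for $v\neq v_0$, for which there are injective edge maps $\phi'_e:Y(n-1;i(e))\hookrightarrow Y(n;f(e))$ ($e\in E$, $n\ge1$) such that $Y(n;v)=\bigsqcup_{e:\,f(e)=v}\phi'_e(Y(n-1;i(e)))$ (disjoint union). For undirected $G$, a Pascal $(G,v_0)$-array $Y$ underlies a sequence of sets $(\mathcal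 C(n))_n$ if there are bijections $\mathcal C(n)\cong\bigsqcup_{v}Y(n;v)\times Y'(n;v)$ for all $n$, with $Y'$ also a Pascal $(G,v_0)$-array. A Temperley–Lieb diagram is a non-crossing pair partition of points on the northern and southern edges of a rectangle, drawn by non-crossing lines inside the rectangle; lines joining a northern and a southern point are propagating. The lines divide the rectangle into regions. A line is $0$-covered if it is part of the boundary of the region containing the western edge; for $m\ge1$ a line is $m$-covered if it is part of the boundary of a region also bounded by an $(m-1)$-covered line, and it is not $m'$-covered for any $m'<m$. A level-$k$ $d$-colour contour algebra diagram is a Temperley–Lieb diagram in which each line that is $k'$-covered for some $k'<k$ may be decorated with any number from $0$ to $d-1$ of blobs, all other lines being undecorated. $Y_{TL,(d^k,1)}(n;(d_1,\dots,d_j))$ is the set of level-$k$ $d$-colour diagrams with $n$ northern points, $j$ southern points and exactly $j$ propagating lines (half-diagrams), in which the $i$-th propagating line from the left carries $d_i-1$ blobs for $i=1,\dots,j$. A diagram in $\mathcal C_{k,d}(n)$ is cut horizontally into an upper and a lower half-diagram by cutting each propagating line once and no other line, a cut propagating line keeping the same number of blobs on both parts; $Y'$ is the array of (reflected) lower half-diagrams. *)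

theory Defs
  imports "HOL-Library.Disjoint_Sets" "Graph_Theory.Digraph"
begin

section \<open>Pascal arrays\<close>

text \<open>An array has values only at the vertices of the graph; \<open>Y n v\<close> for \<open>v\<close> outside \<open>verts G\<close>
  is junk.  The edge maps depend on the level \<open>n\<close> as well as on the edge.\<close>

definition pascal_array ::
  "('v, 'e) pre_digraph \<Rightarrow> 'v \<Rightarrow> (nat \<Rightarrow> 'v \<Rightarrow> 'y set) \<Rightarrow> bool" where
  "pascal_array G v\<^sub>0 Y \<longleftrightarrow>
     (\<exists>y. Y 0 v\<^sub>0 = {y}) \<and>
     (\<forall>v\<in>verts G. v \<noteq> v\<^sub>0 \<longrightarrow> Y 0 v = {}) \<and>
     (\<exists>\<phi> :: nat \<Rightarrow> 'e \<Rightarrow> 'y \<Rightarrow> 'y. \<forall>n\<ge>1.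
        (\<forall>e\<in>arcs G.
           \<phi> n e ` Y (n - 1) (tail G e) \<subseteq> Y n (head G e) \<and>
           inj_on (\<phi> n e) (Y (n - 1) (tail G e))) \<and>
        (\<forall>v\<in>verts G.
           Y n v = (\<Union>e\<in>{e \<in> arcs G. head G e = v}. \<phi> n e ` Y (n - 1) (tail G e)) \<and>
           disjoint_family_on (\<lambda>e. \<phi> n e ` Y (n - 1) (tail G e)) {e \<in> arcs G. head G e = v}))"

text \<open>To be used for undirected \<open>G\<close> only, that is, when the arcs come in opposite pairs.\<close>

definition underlies ::
  "('v, 'e) pre_digraph \<Rightarrow> 'v \<Rightarrow> (nat \<Rightarrow> 'v \<Rightarrow> 'y set) \<Rightarrow> (nat \<Rightarrow> 'c set) \<Rightarrow> bool" where
  "underlies G v\<^sub>0 Y C \<longleftrightarrow>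
     pascal_array G v\<^sub>0 Y \<and>
     (\<exists>Y' :: nat \<Rightarrow> 'v \<Rightarrow> 'y set. pascal_array G v\<^sub>0 Y' \<and>
        (\<forall>n. \<exists>\<beta>. bij_betw \<beta> (C n) (SIGMA v : verts G. Y n v \<times> Y' n v)))"


section \<open>The tree\<close>

text \<open>The sequence \<open>(d\<^sub>1, \<dots>, d\<^sub>j)\<close> is the list with \<open>d\<^sub>i\<close> at index \<open>i - 1\<close>.\<close>

definition contour_tree :: "nat \<Rightarrow> nat \<Rightarrow> (nat list, nat list \<times> nat list) pre_digraph" where
  "contour_tree k d =
     (let V = {v. \<forall>i<length v. 1 \<le> v ! i \<and> v ! i \<le> (if i < k then d else 1)} in
      \<lparr> verts = V,
        arcs = {(u, v). u \<in> V \<and> v \<in> V \<and> (\<exists>x. v = u @ [x] \<or> u = v @ [x])},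
        tail = fst,
        head = snd \<rparr>)"

lemma contour_tree_undirected:
  "wf_digraph (contour_tree k d)" "symmetric (contour_tree k d)"
proof -
  show "wf_digraph (contour_tree k d)"
    by unfold_locales (auto simp: contour_tree_def Let_def)
  show "symmetric (contour_tree k d)"
    unfolding symmetric_def arcs_ends_def arc_to_ends_def contour_tree_def Let_def
    by (rule symI) (auto simp: image_iff)
qed


section \<open>Temperley--Lieb diagrams\<close>

text \<open>Northern and southern points are both numbered from left to right, starting at 1.\<close>

datatype point = North nat | South nat

definition points :: "nat \<Rightarrow> nat \<Rightarrow> point set" where
  "points n m = North ` {1..n} \<union> South ` {1..m}"

text \<open>The place of a point in the clockwise order around the boundary of the rectangle, starting
  from the western edge: the places of the \<open>n + m\<close> points are \<open>1, \<dots>, n + m\<close>.\<close>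

fun pos :: "nat \<Rightarrow> nat \<Rightarrow> point \<Rightarrow> nat" where
  "pos n m (North i) = i"
| "pos n m (South j) = n + m + 1 - j"

text \<open>Two lines can be drawn in the rectangle without crossing each other iff their endpoints do
  not alternate around the boundary.\<close>

definition noncrossing :: "nat \<Rightarrow> nat \<Rightarrow> point set set \<Rightarrow> bool" where
  "noncrossing n m P \<longleftrightarrow>
     \<not> (\<exists>l\<in>P. \<exists>l'\<in>P. \<exists>a\<in>pos n m ` l. \<exists>b\<in>pos n m ` l'. \<exists>a'\<in>pos n m ` l. \<exists>b'\<in>pos n m ` l'.
          a < b \<and> b < a' \<and> a' < b')"

definition tl_diagrams :: "nat \<Rightarrow> nat \<Rightarrow> point set set set" where
  "tl_diagrams n m =
     {P. partition_on (points n m) P \<and> (\<forall>l\<in>P. card l = 2) \<and> noncrossing n m P}"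

definition propagating :: "point set \<Rightarrow> bool" where
  "propagating l \<longleftrightarrow> (\<exists>i j. l = {North i, South j})"


section \<open>Regions and covering\<close>

text \<open>Cutting the boundary of the rectangle at the \<open>n + m\<close> points leaves intervals, here called
  gaps.  Gap \<open>g\<close> lies between places \<open>g\<close> and \<open>g + 1\<close>; gaps \<open>0\<close> and \<open>n + m\<close> are the two ends
  of the same interval, the one that contains the western edge.

  Every region of the rectangle meets the boundary in a nonempty union of gaps, and two gaps belong
  to the same region iff no line separates them.  So a region is represented by the set of its gaps.
  The set \<open>arc n m l\<close> consists of the gaps on the side of the line \<open>l\<close> away from the western edge
  (gaps \<open>0\<close> and \<open>n + m\<close> never lie in it).\<close>

definition arc :: "nat \<Rightarrow> nat \<Rightarrow> point set \<Rightarrow> nat set" where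
  "arc n m l = {Min (pos n m ` l) ..< Max (pos n m ` l)}"

definition separates :: "nat \<Rightarrow> nat \<Rightarrow> point set \<Rightarrow> nat \<Rightarrow> nat \<Rightarrow> bool" where
  "separates n m l g h \<longleftrightarrow> (g \<in> arc n m l) \<noteq> (h \<in> arc n m l)"

definition regions :: "nat \<Rightarrow> nat \<Rightarrow> point set set \<Rightarrow> nat set set" where
  "regions n m P =
     {0..n + m} // {(g, h) \<in> {0..n + m} \<times> {0..n + m}. \<forall>l\<in>P. \<not> separates n m l g h}"

text \<open>The two sides of a line at its endpoint \<open>p\<close> open onto the two gaps adjacent to \<open>p\<close>.\<close>

definition bounds :: "nat \<Rightarrow> nat \<Rightarrow> point set \<Rightarrow> nat set \<Rightarrow> bool" where
  "bounds n m l R \<longleftrightarrow> (\<exists>p\<in>l. pos n m p - 1 \<in> R \<or> pos n m p \<in> R)"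

fun covered :: "nat \<Rightarrow> nat \<Rightarrow> point set set \<Rightarrow> nat \<Rightarrow> point set \<Rightarrow> bool" where
  "covered n m P 0 l \<longleftrightarrow> (\<exists>R\<in>regions n m P. 0 \<in> R \<and> bounds n m l R)"
| "covered n m P (Suc c) l \<longleftrightarrow>
     (\<exists>R\<in>regions n m P. bounds n m l R \<and>
        (\<exists>l'\<in>P. bounds n m l' R \<and> covered n m P c l')) \<and>
     (\<forall>c'<Suc c. \<not> covered n m P c' l)"


section \<open>Contour algebra diagrams\<close>

text \<open>A decorated diagram is the set of its decorated lines \<open>(l, b)\<close>, where \<open>b\<close> is the number of
  blobs on \<open>l\<close>.  The underlying Temperley--Lieb diagram is the domain of this relation.\<close>

type_synonym diagram = "(point set \<times> nat) set"

definition contour_diagrams :: "nat \<Rightarrow> nat \<Rightarrow> nat \<Rightarrow> nat \<Rightarrow> diagram set" where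
  "contour_diagrams k d n m =
     {D. Domain D \<in> tl_diagrams n m \<and> single_valued D \<and>
         (\<forall>(l, b)\<in>D. if \<exists>k'<k. covered n m (Domain D) k' l then b < d else b = 0)}"

text \<open>If there are \<open>j\<close> southern points and \<open>j\<close> propagating lines, then each southern point is the
  end of a propagating line, and the \<open>i\<close>-th propagating line from the left is the one ending at
  \<open>South i\<close>.\<close>

definition half_diagrams :: "nat \<Rightarrow> nat \<Rightarrow> nat \<Rightarrow> nat list \<Rightarrow> diagram set" where
  "half_diagrams k d n v =
     {D \<in> contour_diagrams k d n (length v).
        card {l \<in> Domain D. propagating l} = length v \<and>
        (\<forall>i<length v. \<exists>l b. (l, b) \<in> D \<and> South (i + 1) \<in> l \<and> v ! i = b + 1)}"

definition lower_half_diagrams :: "nat \<Rightarrow> nat \<Rightarrow> nat \<Rightarrow> nat list \<Rightarrow> diagram set" where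
  "lower_half_diagrams k d n v =
     {D \<in> contour_diagrams k d (length v) n.
        card {l \<in> Domain D. propagating l} = length v \<and>
        (\<forall>i<length v. \<exists>l b. (l, b) \<in> D \<and> North (i + 1) \<in> l \<and> v ! i = b + 1)}"

definition relabel :: "(point \<Rightarrow> point) \<Rightarrow> diagram \<Rightarrow> diagram" where
  "relabel f D = (\<lambda>(l, b). (f ` l, b)) ` D"

definition reflect :: "diagram \<Rightarrow> diagram" where
  "reflect = relabel (\<lambda>p. case p of North i \<Rightarrow> South i | South i \<Rightarrow> North i)"

definition reflected_lower_half_diagrams :: "nat \<Rightarrow> nat \<Rightarrow> nat \<Rightarrow> nat list \<Rightarrow> diagram set" where
  "reflected_lower_half_diagrams k d n v = reflect ` lower_half_diagrams k d n v"


section \<open>Cutting a diagram\<close>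

text \<open>The cut meets exactly the propagating lines, so the upper half keeps the lines with a northern
  endpoint, and the southern endpoint of a propagating line is replaced by its rank, from the left,
  among the southern endpoints of propagating lines.  The lower half is obtained in the same way.\<close>

definition upper_half :: "diagram \<Rightarrow> diagram" where
  "upper_half D =
     relabel
       (\<lambda>p. case p of
          North i \<Rightarrow> North i
        | South j \<Rightarrow> South (card {j'. j' \<le> j \<and> (\<exists>l\<in>Domain D. propagating l \<and> South j' \<in> l)}))
       {(l, b) \<in> D. \<exists>i. North i \<in> l}"

definition lower_half :: "diagram \<Rightarrow> diagram" where
  "lower_half D =
     relabel
       (\<lambda>p. case p of
          North i \<Rightarrow> North (card {i'. i' \<le> i \<and> (\<exists>l\<in>Domain D. propagating l \<and> North i' \<in> l)})
        | South j \<Rightarrow> South j)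
       {(l, b) \<in> D. \<exists>j. South j \<in> l}"

end

theory Submission
  imports Defs
begin

text \<open>Read the endpoints of a diagram clockwise, starting from the western edge.  Two lines can be
  drawn without crossing iff their endpoints do not alternate in this linear order, and a line is
  \<open>m\<close>-covered iff exactly \<open>m\<close> lines have endpoints on both sides of it: stepping
  across a line, away from the western edge, leads into a region all of whose other bounding lines lie
  exactly one level deeper (\<open>covered_iff_card_enclosing\<close>).  Being a contour algebra diagram is
  therefore a property of a decorated matching on a finite linear order
  (\<open>contour_diagrams_iff\<close>), and it is preserved when the endpoints are moved by an
  order isomorphism (\<open>decorated_relabel\<close>) or the order is reversed
  (\<open>decorated_converse\<close>).

  In a half-diagram the lines around the \<open>i\<close>-th propagating line are the \<open>i - 1\<close>
  propagating lines to its left, so the bounds on its blobs are those of the tree.  Now look at the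
  last northern point.  If its line is propagating, it is the last propagating line; no point lies
  between its ends in the linear order, so it can be removed without affecting any other line, and
  this deletes the last entry of the label.  Otherwise its line is a cap, and the right end of the cap
  can be bent down to the southern edge, where it becomes the last southern point: this keeps the
  linear order of all endpoints, and appends to the label an entry that records the blobs of the
  cap.  These two moves undo the maps \<open>add_north\<close> along the two kinds of arcs of the tree
  (\<open>pascal_array_half_diagrams\<close>).

  When a diagram is cut, a line around a line with a northern end also has a northern end.  So the
  lines of the upper half keep their depths, and closing the gaps between the southern ends is an
  order isomorphism.  Since propagating lines do not cross, the \<open>i\<close>-th southern and the
  \<open>i\<close>-th northern end of propagating lines belong to the same line; hence both halves have the
  same label and can be glued together again.  Conversely, any two halves with the same label can be
  glued (\<open>cut_bij_betw\<close>).  Reflection reverses the linear order and exchanges the two halves, so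
  that only upper halves need to be studied, and reflected lower half-diagrams are nothing but
  half-diagrams (\<open>reflected_lower_half_diagrams_eq\<close>).\<close>


section \<open>The boundary order of the endpoints\<close>

lemma pair_of_card_two:
  fixes f :: "'a \<Rightarrow> nat"
  assumes "card l = 2" "inj_on f l"
  obtains p q where "l = {p, q}" "f p < f q"
proof -
  obtain p q where pq: "l = {p, q}" "p \<noteq> q"
    using assms(1) by (auto simp: card_2_iff)
  with assms(2) have "f p \<noteq> f q" by (auto simp: inj_on_def)
  then show ?thesis
    using that[of p q] that[of q p] pq by (cases "f p < f q") (auto simp: insert_commute)
qed

text \<open>The order of the places of points around the boundary.  It does not mention the numbers of
  northern and southern points, so one relation serves diagrams of all sizes.\<close>

fun before :: "point \<Rightarrow> point \<Rightarrow> bool" where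
  "before (North i) (North i') \<longleftrightarrow> i < i'"
| "before (North i) (South j) \<longleftrightarrow> True"
| "before (South j) (North i) \<longleftrightarrow> False"
| "before (South j) (South j') \<longleftrightarrow> j' < j"

lemma pos_less_iff_before:
  assumes "p \<in> points n m" "q \<in> points n m"
  shows "pos n m p < pos n m q \<longleftrightarrow> before p q"
  using assms by (cases p; cases q) (auto simp: points_def)

lemma pos_range: "p \<in> points n m \<Longrightarrow> 1 \<le> pos n m p \<and> pos n m p \<le> n + m"
  by (auto simp: points_def)

lemma inj_on_pos: "inj_on (pos n m) (points n m)"
  by (auto simp: inj_on_def points_def)

definition enclosing :: "('a \<Rightarrow> 'a \<Rightarrow> bool) \<Rightarrow> 'a set set \<Rightarrow> 'a set \<Rightarrow> 'a set set" where
  "enclosing r P l = {l' \<in> P. \<exists>a\<in>l'. \<exists>b\<in>l'. \<forall>c\<in>l. r a c \<and> r c b}"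

definition crossing_free :: "('a \<Rightarrow> 'a \<Rightarrow> bool) \<Rightarrow> 'a set set \<Rightarrow> bool" where
  "crossing_free r P \<longleftrightarrow>
     \<not> (\<exists>l\<in>P. \<exists>l'\<in>P. \<exists>a\<in>l. \<exists>b\<in>l'. \<exists>a'\<in>l. \<exists>b'\<in>l'. r a b \<and> r b a' \<and> r a' b')"

lemma noncrossing_iff_crossing_free:
  assumes "\<Union>P \<subseteq> points n m"
  shows "noncrossing n m P \<longleftrightarrow> crossing_free before P"
proof -
  have "(pos n m p < pos n m q) = before p q" if "l \<in> P" "l' \<in> P" "p \<in> l" "q \<in> l'" for l l' p q
    using that assms by (intro pos_less_iff_before) auto
  then show ?thesis unfolding noncrossing_def crossing_free_def by (simp cong: bex_cong)
qed

section \<open>Covering depth is nesting depth\<close>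

context
  fixes n m P
  assumes tl: "P \<in> tl_diagrams n m"
begin

text \<open>Each line is viewed as the interval between the places of its two ends.\<close>

definition lo :: "point set \<Rightarrow> nat" where "lo l = Min (pos n m ` l)"
definition hi :: "point set \<Rightarrow> nat" where "hi l = Max (pos n m ` l)"
definition outer :: "point set \<Rightarrow> point set set" where
  "outer l = {l' \<in> P. lo l' < lo l \<and> hi l < hi l'}"
definition around :: "nat \<Rightarrow> point set set" where
  "around g = {l \<in> P. lo l \<le> g \<and> g < hi l}"

text \<open>Two gaps lie in the same region iff the same lines run around them, so this is the region
  with exactly the lines \<open>X\<close> around it, if there is one.\<close>

definition region_within :: "point set set \<Rightarrow> nat set" where
  "region_within X = {h \<in> {0..n + m}. around h = X}"

lemma line_ends:
  assumes "l \<in> P"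
  obtains p q where "l = {p, q}" "p \<in> points n m" "q \<in> points n m"
    "lo l = pos n m p" "hi l = pos n m q" "pos n m p < pos n m q"
proof -
  have sub: "l \<subseteq> points n m" and "card l = 2"
    using tl assms by (auto simp: tl_diagrams_def partition_on_def)
  then obtain p q where pq: "l = {p, q}" "pos n m p < pos n m q"
    by (metis pair_of_card_two inj_on_pos inj_on_subset)
  then show ?thesis using sub by (intro that[of p q]) (auto simp: lo_def hi_def)
qed

lemma pos_line: "l \<in> P \<Longrightarrow> pos n m ` l = {lo l, hi l}"
  by (erule line_ends) auto

lemma ends_range: "l \<in> P \<Longrightarrow> 1 \<le> lo l \<and> lo l < hi l \<and> hi l \<le> n + m"
  by (erule line_ends) (use pos_range[of _ n m] in auto)

lemma ends_distinct:
  assumes "l \<in> P" "l' \<in> P" "l \<noteq> l'"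
  shows "lo l \<noteq> lo l'" "hi l \<noteq> hi l'" "lo l \<noteq> hi l'"
proof -
  have dj: "l \<inter> l' = {}"
    using tl assms by (auto simp: tl_diagrams_def partition_on_def disjoint_def)
  have sub: "l \<subseteq> points n m" "l' \<subseteq> points n m"
    using tl assms by (auto simp: tl_diagrams_def partition_on_def)
  have "pos n m ` l \<inter> pos n m ` l' = pos n m ` (l \<inter> l')"
    using inj_on_image_Int[OF inj_on_pos sub] by simp
  then have "{lo l, hi l} \<inter> {lo l', hi l'} = {}"
    using dj pos_line assms by simp
  then show "lo l \<noteq> lo l'" "hi l \<noteq> hi l'" "lo l \<noteq> hi l'" by auto
qed

lemma ends_noncrossing:
  assumes "l \<in> P" "l' \<in> P" "lo l < lo l'" "lo l' < hi l"
  shows "hi l' < hi l"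
proof (rule ccontr)
  assume "\<not> hi l' < hi l"
  moreover have "hi l' \<noteq> hi l" using ends_distinct(2) assms by force
  ultimately have "hi l < hi l'" by simp
  moreover note pos_line[OF assms(1)] pos_line[OF assms(2)]
  ultimately have "\<exists>a\<in>pos n m ` l. \<exists>b\<in>pos n m ` l'. \<exists>a'\<in>pos n m ` l. \<exists>b'\<in>pos n m ` l'.
      a < b \<and> b < a' \<and> a' < b'"
    using assms(3,4) by simp
  then have "\<not> noncrossing n m P"
    unfolding noncrossing_def not_not by (rule bexI[OF bexI[OF _ assms(2)] assms(1)])
  then show False using tl by (simp add: tl_diagrams_def)
qed

lemma outer_eq_enclosing: "l \<in> P \<Longrightarrow> outer l = enclosing before P l"
proof -
  assume l: "l \<in> P"
  have "lo l' < lo l \<and> hi l < hi l' \<longleftrightarrow> (\<exists>a\<in>l'. \<exists>b\<in>l'. \<forall>c\<in>l. before a c \<and> before c b)"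
    if l': "l' \<in> P" for l'
  proof -
    have sub: "l \<subseteq> points n m" "l' \<subseteq> points n m"
      using tl l l' by (auto simp: tl_diagrams_def partition_on_def)
    then have "(\<exists>a\<in>l'. \<exists>b\<in>l'. \<forall>c\<in>l. before a c \<and> before c b) \<longleftrightarrow>
      (\<exists>a\<in>l'. \<exists>b\<in>l'. \<forall>c\<in>l. pos n m a < pos n m c \<and> pos n m c < pos n m b)"
      by (simp add: pos_less_iff_before subset_iff cong: bex_cong ball_cong)
    also have "\<dots> \<longleftrightarrow> (\<exists>x\<in>pos n m ` l'. \<exists>y\<in>pos n m ` l'. \<forall>z\<in>pos n m ` l. x < z \<and> z < y)"
      by simp
    also have "\<dots> \<longleftrightarrow> lo l' < lo l \<and> hi l < hi l'"
      unfolding pos_line[OF l] pos_line[OF l'] using ends_range[OF l] ends_range[OF l'] by auto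
    finally show ?thesis by simp
  qed
  then show ?thesis by (auto simp: outer_def enclosing_def)
qed

text \<open>Just outside either end of \<open>l\<close>, the lines running around a gap are the lines around
  \<open>l\<close>; just inside, \<open>l\<close> itself joins them.  So \<open>l\<close> bounds two regions.\<close>

lemma around_ends:
  assumes "l \<in> P"
  shows "around (lo l) = insert l (outer l)" "around (hi l - 1) = insert l (outer l)"
    "around (lo l - 1) = outer l" "around (hi l) = outer l"
proof -
  have r: "1 \<le> lo l \<and> lo l < hi l" using ends_range assms by blast
  have *: "(lo l' \<le> lo l \<and> lo l < hi l') = (lo l' < lo l \<and> hi l < hi l')"
    "(lo l' \<le> hi l - 1 \<and> hi l - 1 < hi l') = (lo l' < lo l \<and> hi l < hi l')"
    "(lo l' \<le> lo l - 1 \<and> lo l - 1 < hi l') = (lo l' < lo l \<and> hi l < hi l')"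
    "(lo l' \<le> hi l \<and> hi l < hi l') = (lo l' < lo l \<and> hi l < hi l')"
    if l': "l' \<in> P" "l' \<noteq> l" for l'
  proof -
    have r': "lo l' < hi l'" using ends_range[OF l'(1)] by blast
    have distinct: "lo l \<noteq> lo l'" "lo l \<noteq> hi l'" "lo l' \<noteq> hi l"
      using ends_distinct[OF assms l'(1)] ends_distinct[OF l'(1) assms] l'(2) by auto
    \<comment> \<open>\<open>l'\<close> is around \<open>l\<close>, or left of it, or inside it, or right of it\<close>
    consider "lo l' < lo l" "lo l < hi l'" "hi l < hi l'" | "hi l' < lo l"
      | "lo l < lo l'" "hi l' < hi l" | "hi l < lo l'"
      using ends_noncrossing[OF assms l'(1)] ends_noncrossing[OF l'(1) assms] distinct
      by (meson linorder_neqE_nat)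
    then show "(lo l' \<le> lo l \<and> lo l < hi l') = (lo l' < lo l \<and> hi l < hi l')"
      "(lo l' \<le> hi l - 1 \<and> hi l - 1 < hi l') = (lo l' < lo l \<and> hi l < hi l')"
      "(lo l' \<le> lo l - 1 \<and> lo l - 1 < hi l') = (lo l' < lo l \<and> hi l < hi l')"
      "(lo l' \<le> hi l \<and> hi l < hi l') = (lo l' < lo l \<and> hi l < hi l')"
      using r r' by (cases; linarith)+
  qed
  have self: "l \<in> around (lo l)" "l \<in> around (hi l - 1)" "l \<notin> around (lo l - 1)" "l \<notin> around (hi l)"
    "l \<notin> outer l"
    unfolding around_def outer_def using r assms by auto
  have other: "l' \<in> around (lo l) \<longleftrightarrow> l' \<in> outer l" "l' \<in> around (hi l - 1) \<longleftrightarrow> l' \<in> outer l"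
    "l' \<in> around (lo l - 1) \<longleftrightarrow> l' \<in> outer l" "l' \<in> around (hi l) \<longleftrightarrow> l' \<in> outer l"
    if "l' \<noteq> l" for l'
    unfolding around_def outer_def mem_Collect_eq
    by (rule conj_cong[OF refl], erule *[OF _ that])+
  have mem: "x \<in> around (lo l) \<longleftrightarrow> x \<in> insert l (outer l)"
    "x \<in> around (hi l - 1) \<longleftrightarrow> x \<in> insert l (outer l)"
    "x \<in> around (lo l - 1) \<longleftrightarrow> x \<in> outer l" "x \<in> around (hi l) \<longleftrightarrow> x \<in> outer l" for x
    by (cases "x = l"; simp only: self other insert_iff simp_thms)+
  show "around (lo l) = insert l (outer l)" by (rule set_eqI) (rule mem)
  show "around (hi l - 1) = insert l (outer l)" by (rule set_eqI) (rule mem)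
  show "around (lo l - 1) = outer l" by (rule set_eqI) (rule mem)
  show "around (hi l) = outer l" by (rule set_eqI) (rule mem)
qed

lemma regions_eq: "regions n m P = region_within ` around ` {0..n + m}"
proof -
  have "(\<forall>l\<in>P. \<not> separates n m l g h) \<longleftrightarrow> around h = around g" for g h
    unfolding separates_def arc_def around_def lo_def[symmetric] hi_def[symmetric] by auto
  then show ?thesis
    unfolding regions_def quotient_def region_within_def by auto
qed

lemma bounds_iff:
  assumes "l \<in> P" 
  shows "bounds n m l (region_within X) \<longleftrightarrow> X = outer l \<or> X = insert l (outer l)"
proof -
  have "bounds n m l R \<longleftrightarrow> lo l - 1 \<in> R \<or> lo l \<in> R \<or> hi l - 1 \<in> R \<or> hi l \<in> R" for R
  proof -
    have "bounds n m l R \<longleftrightarrow> (\<exists>x \<in> pos n m ` l. x - 1 \<in> R \<or> x \<in> R)"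
      by (auto simp: bounds_def)
    then show ?thesis using pos_line[OF assms] by auto
  qed
  moreover have "g \<in> region_within X \<longleftrightarrow> X = around g" if "g \<le> n + m" for g
    using that by (auto simp: region_within_def)
  moreover have "lo l - 1 \<le> n + m" "lo l \<le> n + m" "hi l - 1 \<le> n + m" "hi l \<le> n + m"
    using ends_range[OF assms] by auto
  ultimately show ?thesis using around_ends[OF assms] by metis
qed

lemma covered_0_iff: "l \<in> P \<Longrightarrow> covered n m P 0 l \<longleftrightarrow> outer l = {}"
proof -
  assume l: "l \<in> P"
  have "\<not> lo l' \<le> 0" if "l' \<in> P" for l' using ends_range[OF that] by simp
  then have a0: "around 0 = {}" unfolding around_def by blast
  have mem: "0 \<in> region_within X \<longleftrightarrow> X = {}" for X using a0 by (auto simp: region_within_def)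
  have west: "region_within {} \<in> regions n m P"
    unfolding regions_eq by (rule imageI, rule image_eqI[of _ _ 0]) (simp_all add: a0)
  have "covered n m P 0 l \<longleftrightarrow> bounds n m l (region_within {})"
  proof
    assume "covered n m P 0 l"
    then obtain R where R: "R \<in> regions n m P" "0 \<in> R" "bounds n m l R"
      unfolding covered.simps by (elim bexE conjE)
    from R(1) obtain X where "R = region_within X"
      unfolding regions_eq by (rule imageE)
    with R(2,3) mem show "bounds n m l (region_within {})" by simp
  next
    assume "bounds n m l (region_within {})"
    then show "covered n m P 0 l"
      unfolding covered.simps using west mem[of "{}"] by (intro bexI[of _ "region_within {}"]) simp_all
  qed
  also have "\<dots> \<longleftrightarrow> outer l = {}" using bounds_iff[OF l] by auto
  finally show ?thesis .
qed

lemma finite_P: "finite P"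
proof -
  have "finite (points n m)" by (simp add: points_def)
  moreover have "P \<subseteq> Pow (points n m)" using tl by (auto simp: tl_diagrams_def partition_on_def)
  ultimately show ?thesis by (meson finite_Pow_iff finite_subset)
qed

text \<open>Crossing the innermost of the lines around \<open>l\<close> loses only that line, because the lines
  around \<open>l\<close> are nested in one another.\<close>

lemma outer_parent:
  assumes "l \<in> P" "outer l \<noteq> {}"
  shows "\<exists>l'\<in>P. insert l' (outer l') = outer l"
proof -
  have fin: "finite (outer l)" using finite_P by (auto simp: outer_def)
  \<comment> \<open>the innermost line around \<open>l\<close> is the one that begins last\<close>
  define x where "x = Max (lo ` outer l)"
  have "x \<in> lo ` outer l" using fin assms by (auto simp: x_def)
  then obtain l' where l': "l' \<in> outer l" "lo l' = x" by auto
  have le: "lo l'' \<le> lo l'" if "l'' \<in> outer l" for l''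
    using that fin l'(2) by (auto simp: x_def)
  have P': "l' \<in> P" using l' by (simp add: outer_def)
  have inner: "l'' \<in> outer l'" if "l'' \<in> outer l" "l'' \<noteq> l'" for l''
  proof -
    have "l'' \<in> P" using that by (simp add: outer_def)
    then have "lo l'' < lo l'" using le[OF that(1)] ends_distinct(1)[of l'' l'] that P' by fastforce
    moreover have "lo l' < hi l''" using l' that ends_range[OF assms(1)] by (auto simp: outer_def)
    ultimately show ?thesis using ends_noncrossing[OF \<open>l'' \<in> P\<close> P'] \<open>l'' \<in> P\<close> by (auto simp: outer_def)
  qed
  have "outer l' \<subseteq> outer l" using l'(1) by (auto simp: outer_def)
  then have "insert l' (outer l') = outer l" using inner l'(1) by blast
  then show ?thesis using P' by blast
qed

text \<open>The regions that a line of depth \<open>c\<close> bounds have \<open>c\<close> or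
  \<open>c + 1\<close> lines around them.  So lines that bound a common region differ in depth by at most
  one, and a line of positive depth shares its outer region with the innermost line around it.\<close>

lemma covered_iff_card_outer: "l \<in> P \<Longrightarrow> covered n m P c l \<longleftrightarrow> card (outer l) = c"
proof (induction c arbitrary: l rule: less_induct)
  case (less c)
  have fin: "finite (outer l)" for l using finite_P by (auto simp: outer_def)
  have self: "l \<notin> outer l" for l by (auto simp: outer_def)
  show ?case
  proof (cases c)
    case 0
    then show ?thesis using covered_0_iff[OF less.prems] fin by simp
  next
    case (Suc c')
    have IH: "covered n m P c'' l' \<longleftrightarrow> card (outer l') = c''" if "c'' < Suc c'" "l' \<in> P" for c'' l'
      using less.IH that Suc by simp
    let ?adjacent = "\<exists>R\<in>regions n m P. bounds n m l R \<and> (\<exists>l'\<in>P. bounds n m l' R \<and> covered n m P c' l')"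
    have "(\<forall>c''<Suc c'. \<not> covered n m P c'' l) \<longleftrightarrow> (\<forall>c''<Suc c'. card (outer l) \<noteq> c'')"
      using IH[OF _ less.prems] by simp
    then have smaller: "(\<forall>c''<Suc c'. \<not> covered n m P c'' l) \<longleftrightarrow> Suc c' \<le> card (outer l)"
      using not_less by blast
    have le: "card (outer l) \<le> Suc c'" if ?adjacent
    proof -
      from that obtain R l' where R: "R \<in> regions n m P" "bounds n m l R"
        "l' \<in> P" "bounds n m l' R" "covered n m P c' l'"
        by (elim bexE conjE)
      from R(1) obtain X where "R = region_within X"
        unfolding regions_eq by (rule imageE)
      then have "X = outer l \<or> X = insert l (outer l)" "X = outer l' \<or> X = insert l' (outer l')"
        using R(2,4) bounds_iff[OF less.prems] bounds_iff[OF R(3)] by simp_all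
      moreover have "card (outer l') = c'" using IH R(3,5) by simp
      ultimately have "card (outer l) \<le> card X" "card X \<le> Suc c'"
        using fin self by (auto simp: card_insert_if)
      then show ?thesis by simp
    qed
    have adjacent: ?adjacent if c: "card (outer l) = Suc c'"
    proof -
      have "outer l \<noteq> {}" using c by auto
      from outer_parent[OF less.prems this]
      obtain l' where l': "l' \<in> P" "insert l' (outer l') = outer l" by (elim bexE)
      then have "Suc (card (outer l')) = Suc c'"
        using card_insert_disjoint[OF fin self, of l'] c by simp
      then have "covered n m P c' l'" using IH l'(1) by simp
      moreover have "bounds n m l' (region_within (outer l))"
        using bounds_iff[OF l'(1)] l'(2) by simp
      moreover have "bounds n m l (region_within (outer l))"
        using bounds_iff[OF less.prems] by simp
      moreover have "region_within (outer l) \<in> regions n m P"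
        unfolding regions_eq around_ends(4)[OF less.prems, symmetric]
        using ends_range[OF less.prems] by (intro imageI) simp
      ultimately show ?thesis using l'(1) by (intro bexI conjI)
    qed
    show ?thesis
      unfolding Suc covered.simps(2) smaller using le adjacent le_antisym by (metis order_refl)
  qed
qed

lemma covered_iff_card_enclosing: "l \<in> P \<Longrightarrow> covered n m P c l \<longleftrightarrow> card (enclosing before P l) = c"
  using covered_iff_card_outer[of l c] outer_eq_enclosing[of l] by metis

end

text \<open>The order is a parameter because reflection reverses it.\<close>

definition planar_matching :: "('a \<Rightarrow> 'a \<Rightarrow> bool) \<Rightarrow> 'a set \<Rightarrow> 'a set set \<Rightarrow> bool" where
  "planar_matching r S P \<longleftrightarrow> partition_on S P \<and> (\<forall>l\<in>P. card l = 2) \<and> crossing_free r P"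

text \<open>Contour algebra diagrams on an arbitrary set of points.  A part of a diagram is again of this
  kind, although its points need not be numbered consecutively.\<close>

definition decorated ::
  "nat \<Rightarrow> nat \<Rightarrow> (point \<Rightarrow> point \<Rightarrow> bool) \<Rightarrow> point set \<Rightarrow> diagram \<Rightarrow> bool" where
  "decorated k d r S D \<longleftrightarrow> planar_matching r S (Domain D) \<and> single_valued D \<and>
     (\<forall>(l, b)\<in>D. if card (enclosing r (Domain D) l) < k then b < d else b = 0)"

lemma contour_diagrams_iff:
  "D \<in> contour_diagrams k d n m \<longleftrightarrow> decorated k d before (points n m) D"
proof -
  have nc: "noncrossing n m (Domain D) \<longleftrightarrow> crossing_free before (Domain D)"
    if "partition_on (points n m) (Domain D)"
    using partition_onD1[OF that] by (intro noncrossing_iff_crossing_free equalityD2)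
  have depth: "(\<exists>k'<k. covered n m (Domain D) k' (fst x)) \<longleftrightarrow> card (enclosing before (Domain D) (fst x)) < k"
    if T: "Domain D \<in> tl_diagrams n m" and x: "x \<in> D" for x
  proof -
    have "fst x \<in> Domain D" using x by (intro DomainI[of _ "snd x"]) simp
    from covered_iff_card_enclosing[OF T this] show ?thesis by simp
  qed
  have "(\<forall>(l, b)\<in>D. if \<exists>k'<k. covered n m (Domain D) k' l then b < d else b = 0) \<longleftrightarrow>
      (\<forall>(l, b)\<in>D. if card (enclosing before (Domain D) l) < k then b < d else b = 0)"
    if T: "Domain D \<in> tl_diagrams n m"
    unfolding case_prod_beta by (intro ball_cong refl) (simp only: depth[OF T])
  then show ?thesis
    unfolding contour_diagrams_def decorated_def planar_matching_def mem_Collect_eq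
    unfolding tl_diagrams_def mem_Collect_eq using nc by argo
qed

section \<open>Relabelling, sub-diagrams and reflection\<close>

lemma crossing_freeD:
  assumes "crossing_free r P" "l \<in> P" "l' \<in> P" "a \<in> l" "b \<in> l'" "a' \<in> l" "b' \<in> l'"
    "r a b" "r b a'"
  shows "\<not> r a' b'"
proof
  assume "r a' b'"
  then have "\<exists>x\<in>l. \<exists>y\<in>l'. \<exists>x'\<in>l. \<exists>y'\<in>l'. r x y \<and> r y x' \<and> r x' y'"
    using assms(4-) by blast
  then have "\<not> crossing_free r P"
    unfolding crossing_free_def not_not by (rule bexI[OF bexI[OF _ assms(3)] assms(2)])
  then show False using assms(1) by contradiction
qed

lemma planar_matching_line:
  assumes "planar_matching r S P" "l \<in> P"
  shows "l \<subseteq> S" "card l = 2"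
  using assms by (auto simp: planar_matching_def partition_on_def)

lemma planar_matching_same_line:
  assumes "planar_matching r S P" "l \<in> P" "l' \<in> P" "p \<in> l" "p \<in> l'"
  shows "l = l'"
proof -
  have "disjoint P" using assms(1) by (simp add: planar_matching_def partition_on_def)
  then show ?thesis using assms(2-) by (auto simp: disjoint_def)
qed

lemma planar_matching_points: "planar_matching r S P \<Longrightarrow> \<Union>P = S"
  by (simp add: planar_matching_def partition_on_def)

lemma planar_matchingI:
  assumes "\<Union>P = S"
    "\<And>l l' p. l \<in> P \<Longrightarrow> l' \<in> P \<Longrightarrow> p \<in> l \<Longrightarrow> p \<in> l' \<Longrightarrow> l = l'"
    "\<And>l. l \<in> P \<Longrightarrow> card l = 2"
    "crossing_free r P"
  shows "planar_matching r S P"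
proof -
  have "disjoint P" using assms(2) unfolding disjoint_def by blast
  moreover have "{} \<notin> P"
  proof
    assume "{} \<in> P"
    from assms(3)[OF this] show False by simp
  qed
  ultimately show ?thesis
    using assms(1,3,4) by (simp add: planar_matching_def partition_on_def)
qed

lemma decorated_matching: "decorated k d r S D \<Longrightarrow> planar_matching r S (Domain D)"
  by (simp add: decorated_def)

lemmas decorated_line = planar_matching_line[OF decorated_matching]
  and decorated_same_line = planar_matching_same_line[OF decorated_matching]
  and decorated_points = planar_matching_points[OF decorated_matching]

lemma decorated_same_blobs:
  assumes "decorated k d r S D" "(l, b) \<in> D" "(l, b') \<in> D"
  shows "b = b'"
  using assms by (auto simp: decorated_def single_valued_def)

lemma decorated_blobs:
  assumes "decorated k d r S D" "(l, b) \<in> D"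
  shows "if card (enclosing r (Domain D) l) < k then b < d else b = 0"
proof -
  have "\<forall>(l, b)\<in>D. if card (enclosing r (Domain D) l) < k then b < d else b = 0"
    using assms(1) by (simp add: decorated_def)
  from bspec[OF this assms(2)] show ?thesis by simp
qed

lemma decoratedI:
  assumes "planar_matching r S (Domain D)"
    "\<And>l b b'. (l, b) \<in> D \<Longrightarrow> (l, b') \<in> D \<Longrightarrow> b = b'"
    "\<And>l b. (l, b) \<in> D \<Longrightarrow> if card (enclosing r (Domain D) l) < k then b < d else b = 0"
  shows "decorated k d r S D"
proof -
  have "single_valued D" using assms(2) by (intro single_valuedI)
  moreover have "\<forall>(l, b)\<in>D. if card (enclosing r (Domain D) l) < k then b < d else b = 0"
    using assms(3) by (intro ballI case_prodI2) simp
  ultimately show ?thesis unfolding decorated_def using assms(1) by simp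
qed

lemma Domain_relabel: "Domain (relabel f D) = (`) f ` Domain D"
  unfolding relabel_def Domain_fst image_image case_prod_beta by simp

lemma mem_relabelI: "(l, b) \<in> D \<Longrightarrow> (f ` l, b) \<in> relabel f D"
  unfolding relabel_def by (rule image_eqI[of _ _ "(l, b)"]) simp_all

lemma mem_relabelE:
  assumes "(l, b) \<in> relabel f D"
  obtains l' where "l = f ` l'" "(l', b) \<in> D"
  using assms unfolding relabel_def by auto

lemma relabel_relabel: "relabel g (relabel f D) = relabel (g \<circ> f) D"
  by (simp add: relabel_def image_image case_prod_beta image_comp)

lemma relabel_cong:
  assumes "\<And>p. p \<in> \<Union>(Domain D) \<Longrightarrow> f p = g p"
  shows "relabel f D = relabel g D"
proof -
  have "f ` fst x = g ` fst x" if "x \<in> D" for x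
  proof (rule image_cong[OF refl])
    fix p assume "p \<in> fst x"
    moreover have "fst x \<in> Domain D" using that by (intro DomainI[of _ "snd x"]) simp
    ultimately show "f p = g p" using assms by blast
  qed
  then show ?thesis unfolding relabel_def case_prod_beta by (intro image_cong) simp_all
qed

lemma relabel_ident:
  assumes "\<And>p. p \<in> \<Union>(Domain D) \<Longrightarrow> f p = p"
  shows "relabel f D = D"
proof -
  have "relabel f D = relabel (\<lambda>p. p) D" using assms by (intro relabel_cong) simp
  then show ?thesis by (simp add: relabel_def)
qed

lemma crossing_free_image:
  assumes "\<And>l. l \<in> P \<Longrightarrow> l \<subseteq> S"
    "\<And>x y. x \<in> S \<Longrightarrow> y \<in> S \<Longrightarrow> r' (f x) (f y) = r x y"
  shows "crossing_free r' ((`) f ` P) = crossing_free r P"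
proof -
  have "r' (f x) (f y) = r x y" if "l \<in> P" "l' \<in> P" "x \<in> l" "y \<in> l'" for l l' x y
    using assms(2) assms(1)[OF that(1)] assms(1)[OF that(2)] that(3,4) by blast
  then show ?thesis unfolding crossing_free_def by (simp cong: bex_cong)
qed

lemma enclosing_image:
  assumes "\<And>l. l \<in> P \<Longrightarrow> l \<subseteq> S" "l \<in> P"
    "\<And>x y. x \<in> S \<Longrightarrow> y \<in> S \<Longrightarrow> r' (f x) (f y) = r x y"
  shows "enclosing r' ((`) f ` P) (f ` l) = (`) f ` enclosing r P l"
proof -
  have "r' (f x) (f y) = r x y" if "l \<in> P" "l' \<in> P" "x \<in> l" "y \<in> l'" for l l' x y
    using assms(3) assms(1)[OF that(1)] assms(1)[OF that(2)] that(3,4) by blast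
  then have "(\<exists>a\<in>f ` l'. \<exists>b\<in>f ` l'. \<forall>c\<in>f ` l. r' a c \<and> r' c b) \<longleftrightarrow>
    (\<exists>a\<in>l'. \<exists>b\<in>l'. \<forall>c\<in>l. r a c \<and> r c b)" if "l' \<in> P" for l'
    using that assms(2) by (simp cong: bex_cong ball_cong)
  then have "{l' \<in> P. \<exists>a\<in>f ` l'. \<exists>b\<in>f ` l'. \<forall>c\<in>f ` l. r' a c \<and> r' c b} = enclosing r P l"
    unfolding enclosing_def by (intro Collect_cong conj_cong refl)
  moreover have "{x \<in> (`) f ` P. Q x} = (`) f ` {l' \<in> P. Q (f ` l')}" for Q by auto
  ultimately show ?thesis unfolding enclosing_def by simp
qed

text \<open>Everything that is required of a decorated diagram speaks only of the order of the endpoints,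
  so it survives an order isomorphism.\<close>

lemma decorated_relabel:
  assumes dec: "decorated k d r S D" and inj: "inj_on f S"
    and mono: "\<And>x y. x \<in> S \<Longrightarrow> y \<in> S \<Longrightarrow> r' (f x) (f y) = r x y"
  shows "decorated k d r' (f ` S) (relabel f D)"
proof (intro decoratedI planar_matchingI)
  note sub = decorated_line(1)[OF dec]
  have inj_lines: "inj_on ((`) f) (Domain D)"
    using inj_on_image_Pow[OF inj] by (rule inj_on_subset) (use sub in auto)
  show "\<Union>(Domain (relabel f D)) = f ` S"
    unfolding Domain_relabel image_Union[symmetric] decorated_points[OF dec] ..
  show "l = l'"
    if l: "l \<in> Domain (relabel f D)" "l' \<in> Domain (relabel f D)" and p: "p \<in> l" "p \<in> l'" for l l' p
  proof -
    obtain h h' where h: "h \<in> Domain D" "l = f ` h" "h' \<in> Domain D" "l' = f ` h'"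
      using l unfolding Domain_relabel by (elim imageE)
    then obtain x y where xy: "x \<in> h" "y \<in> h'" "f x = p" "f y = p" using p by auto
    then have "x = y" using inj_onD[OF inj, of x y] sub h by auto
    then show ?thesis using decorated_same_line[OF dec] h xy by metis
  qed
  show "card l = 2" if l: "l \<in> Domain (relabel f D)" for l
  proof -
    obtain h where k: "h \<in> Domain D" "l = f ` h" using l unfolding Domain_relabel by (elim imageE)
    then show ?thesis
      using card_image[OF inj_on_subset[OF inj sub]] decorated_line(2)[OF dec] by simp
  qed
  show "crossing_free r' (Domain (relabel f D))"
    unfolding Domain_relabel using crossing_free_image[of "Domain D" S r' f r] sub mono dec by (simp add: decorated_def planar_matching_def)
  show "b = b'" if lb: "(l, b) \<in> relabel f D" "(l, b') \<in> relabel f D" for l b b'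
  proof -
    obtain k k' where k: "(k, b) \<in> D" "l = f ` k" "(k', b') \<in> D" "l = f ` k'"
      using lb by (elim mem_relabelE)
    then have "k = k'" using inj_onD[OF inj_lines, of k k'] by auto
    then show ?thesis using decorated_same_blobs[OF dec] k by blast
  qed
  show "if card (enclosing r' (Domain (relabel f D)) l) < k then b < d else b = 0"
    if lb: "(l, b) \<in> relabel f D" for l b
  proof -
    obtain h where h: "(h, b) \<in> D" "l = f ` h" using lb by (elim mem_relabelE)
    then have "h \<in> Domain D" by auto
    then have "enclosing r' (Domain (relabel f D)) l = (`) f ` enclosing r (Domain D) h"
      unfolding Domain_relabel h(2) using sub mono by (intro enclosing_image)
    moreover have "inj_on ((`) f) (enclosing r (Domain D) h)"
      using inj_lines by (rule inj_on_subset) (simp add: enclosing_def)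
    ultimately show ?thesis using decorated_blobs[OF dec h(1)] by (simp add: card_image)
  qed
qed

lemma enclosing_sub:
  assumes "P' \<subseteq> P" "enclosing r P l \<subseteq> P'"
  shows "enclosing r P' l = enclosing r P l"
  using assms unfolding enclosing_def by blast

lemma crossing_free_sub: "crossing_free r P \<Longrightarrow> P' \<subseteq> P \<Longrightarrow> crossing_free r P'"
  unfolding crossing_free_def by (meson subsetD)

text \<open>A set of lines that contains the lines around each of its members can be taken out of a
  diagram without changing depths.\<close>

lemma decorated_sub:
  assumes dec: "decorated k d r S D" and "D' \<subseteq> D"
    and closed: "\<And>l. l \<in> Domain D' \<Longrightarrow> enclosing r (Domain D) l \<subseteq> Domain D'"
  shows "decorated k d r (\<Union>(Domain D')) D'"
proof (intro decoratedI planar_matchingI)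
  have sub: "Domain D' \<subseteq> Domain D" using \<open>D' \<subseteq> D\<close> by auto
  show "l = l'" if "l \<in> Domain D'" "l' \<in> Domain D'" "p \<in> l" "p \<in> l'" for l l' p
    using decorated_same_line[OF dec] that sub by blast
  show "card l = 2" if "l \<in> Domain D'" for l
    using decorated_line(2)[OF dec] that sub by blast
  show "crossing_free r (Domain D')"
    using crossing_free_sub[OF _ sub] dec by (simp add: decorated_def planar_matching_def)
  show "b = b'" if "(l, b) \<in> D'" "(l, b') \<in> D'" for l b b'
    using decorated_same_blobs[OF dec] that \<open>D' \<subseteq> D\<close> by blast
  show "if card (enclosing r (Domain D') l) < k then b < d else b = 0" if lb: "(l, b) \<in> D'" for l b
  proof -
    have "l \<in> Domain D'" using lb by auto
    then show ?thesis
      using decorated_blobs[OF dec, of l b] lb \<open>D' \<subseteq> D\<close> enclosing_sub[OF sub closed] by auto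
  qed
qed simp

text \<open>Both alternation of endpoints and enclosure are symmetric under reversal of the order.\<close>

lemma decorated_converse: "decorated k d (\<lambda>x y. r y x) S D = decorated k d r S D"
proof -
  have "crossing_free (\<lambda>x y. r y x) (Domain D) = crossing_free r (Domain D)"
    unfolding crossing_free_def by blast
  moreover have "enclosing (\<lambda>x y. r y x) (Domain D) l = enclosing r (Domain D) l" for l
    unfolding enclosing_def by blast
  ultimately show ?thesis unfolding decorated_def planar_matching_def by simp
qed

definition flip :: "point \<Rightarrow> point" where
  "flip = (\<lambda>p. case p of North i \<Rightarrow> South i | South i \<Rightarrow> North i)"

lemma flip_simps [simp]: "flip (North i) = South i" "flip (South i) = North i"
  by (simp_all add: flip_def)

lemma flip_flip [simp]: "flip (flip p) = p"
  by (cases p) simp_all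

lemma reflect_eq: "reflect = relabel flip"
  by (simp add: reflect_def flip_def)

lemma reflect_reflect [simp]: "reflect (reflect D) = D"
  by (simp add: reflect_eq relabel_relabel relabel_ident)

lemma before_flip: "before (flip p) (flip q) = before q p"
  by (cases p; cases q) auto

lemma flip_points: "flip ` points n m = points m n"
  by (auto simp: points_def image_Un image_image)

lemma decorated_reflect:
  assumes "decorated k d before S D"
  shows "decorated k d before (flip ` S) (reflect D)"
proof -
  have "inj flip" by (metis injI flip_flip)
  then have "decorated k d (\<lambda>x y. before y x) (flip ` S) (relabel flip D)"
    using assms by (intro decorated_relabel[where r = before]) (auto simp: before_flip intro: inj_on_subset)
  then show ?thesis by (simp add: decorated_converse[where r = before] reflect_eq)
qed

lemma mem_reflect: "(l, b) \<in> reflect D \<longleftrightarrow> (flip ` l, b) \<in> D"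
proof -
  have ff: "flip ` flip ` l = l" for l by (simp add: image_image)
  show ?thesis
  proof
    assume "(l, b) \<in> reflect D"
    then show "(flip ` l, b) \<in> D" unfolding reflect_eq by (elim mem_relabelE) (simp add: ff)
  next
    assume "(flip ` l, b) \<in> D"
    from mem_relabelI[OF this, of flip] show "(l, b) \<in> reflect D" by (simp add: ff reflect_eq)
  qed
qed

lemma mem_reflect_pair: "({North a, South c}, b) \<in> reflect D \<longleftrightarrow> ({North c, South a}, b) \<in> D"
  by (simp add: mem_reflect insert_commute)

section \<open>Propagating lines and half-diagrams\<close>

definition propagating_pairs :: "point set set \<Rightarrow> (nat \<times> nat) set" where
  "propagating_pairs P = {(i, j). {North i, South j} \<in> P}"

lemma mem_propagating_pairs: "(i, j) \<in> propagating_pairs P \<longleftrightarrow> {North i, South j} \<in> P"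
  by (simp add: propagating_pairs_def)

lemma doubleton_North_South_eq [simp]:
  "{North i, South j} = {North i', South j'} \<longleftrightarrow> i = i' \<and> j = j'"
  by (auto simp: doubleton_eq_iff)

lemma propagating_pair_range:
  assumes "planar_matching r (points n m) P" "(i, j) \<in> propagating_pairs P"
  shows "i \<in> {1..n}" "j \<in> {1..m}"
  using planar_matching_line(1)[OF assms(1), of "{North i, South j}"] assms(2)
  by (auto simp: propagating_pairs_def points_def)

lemma propagating_pair_unique:
  assumes M: "planar_matching r S P" "(i, j) \<in> propagating_pairs P" "(i', j') \<in> propagating_pairs P"
  shows "i = i' \<longleftrightarrow> j = j'"
proof -
  have "{North i, South j} = {North i', South j'}" if "p \<in> {North i, South j}" "p \<in> {North i', South j'}" for p
    using planar_matching_same_line[OF M(1) _ _ that] M(2,3) by (simp add: mem_propagating_pairs)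
  from this[of "North i"] this[of "South j"] show ?thesis by auto
qed

text \<open>Propagating lines are ordered from left to right, the same way at both ends: two that changed
  places would cross.\<close>

lemma propagating_pair_order:
  assumes M: "planar_matching before S P" "(i, j) \<in> propagating_pairs P" "(i', j') \<in> propagating_pairs P"
  shows "i < i' \<longleftrightarrow> j < j'"
proof -
  have *: "\<not> (i < i' \<and> j' < j)"
    if ij: "(i, j) \<in> propagating_pairs P" "(i', j') \<in> propagating_pairs P" for i j i' j'
    using crossing_freeD[of before P "{North i, South j}" "{North i', South j'}"
        "North i" "North i'" "South j" "South j'"] M(1) ij
    by (auto simp: planar_matching_def mem_propagating_pairs)
  show ?thesis
    using *[OF M(2,3)] *[OF M(3,2)] propagating_pair_unique[OF M] by linarith
qed

lemma inj_on_fst_propagating_pairs: "planar_matching r S P \<Longrightarrow> inj_on fst (propagating_pairs P)"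
  by (auto intro!: inj_onI dest: propagating_pair_unique)

lemma inj_on_snd_propagating_pairs: "planar_matching r S P \<Longrightarrow> inj_on snd (propagating_pairs P)"
  by (auto intro!: inj_onI dest: propagating_pair_unique)

lemma finite_propagating_pairs:
  assumes "planar_matching r (points n m) P"
  shows "finite (propagating_pairs P)"
proof (rule finite_subset)
  show "propagating_pairs P \<subseteq> {1..n} \<times> {1..m}"
    using propagating_pair_range[OF assms] by auto
qed simp

lemma inj_on_pair_line: "inj_on (\<lambda>(i, j). {North i, South j}) A"
  by (auto intro!: inj_onI)

lemma propagating_lines_eq:
  "{l \<in> P. propagating l} = (\<lambda>(i, j). {North i, South j}) ` propagating_pairs P"
  by (auto simp: propagating_def propagating_pairs_def)

text \<open>A propagating line is determined by its southern end.\<close>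

lemma card_propagating_lines:
  assumes "planar_matching r S P"
  shows "card {l \<in> P. propagating l} = card (snd ` propagating_pairs P)"
  unfolding propagating_lines_eq
  by (simp add: card_image inj_on_pair_line inj_on_snd_propagating_pairs[OF assms])

text \<open>Every southern point is asked to end a propagating line, rather than counting these lines;
  counting amounts to the same, as each southern point ends at most one line
  (\<open>half_diagrams_iff\<close> below).\<close>

definition half_diagram :: "nat \<Rightarrow> nat \<Rightarrow> nat \<Rightarrow> nat list \<Rightarrow> diagram \<Rightarrow> bool" where
  "half_diagram k d n v D \<longleftrightarrow> decorated k d before (points n (length v)) D \<and>
     (\<forall>i<length v. \<exists>a b. ({North a, South (Suc i)}, b) \<in> D \<and> v ! i = Suc b)"

lemma half_diagram_decorated:
  "half_diagram k d n v D \<Longrightarrow> decorated k d before (points n (length v)) D"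
  by (simp add: half_diagram_def)

lemmas half_diagram_matching = decorated_matching[OF half_diagram_decorated]

lemma half_diagram_souths:
  assumes "half_diagram k d n v D"
  shows "snd ` propagating_pairs (Domain D) = {1..length v}"
proof -
  have M: "planar_matching before (points n (length v)) (Domain D)"
    by (rule half_diagram_matching[OF assms])
  show ?thesis
  proof (intro equalityI subsetI)
    fix j assume "j \<in> snd ` propagating_pairs (Domain D)"
    then show "j \<in> {1..length v}" using propagating_pair_range(2)[OF M] by auto
  next
    fix j assume "j \<in> {1..length v}"
    then have "j - 1 < length v" "Suc (j - 1) = j" by auto
    then obtain a b where "({North a, South j}, b) \<in> D"
      using assms unfolding half_diagram_def by metis
    then have "(a, j) \<in> propagating_pairs (Domain D)" by (auto simp: mem_propagating_pairs)
    then show "j \<in> snd ` propagating_pairs (Domain D)" by force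
  qed
qed

lemma half_diagrams_iff: "D \<in> half_diagrams k d n v \<longleftrightarrow> half_diagram k d n v D"
proof (cases "decorated k d before (points n (length v)) D")
  case True
  let ?pp = "propagating_pairs (Domain D)"
  note M = decorated_matching[OF True]
  have card: "card {l \<in> Domain D. propagating l} = card (snd ` ?pp)"
    by (rule card_propagating_lines[OF M])
  have sub: "snd ` ?pp \<subseteq> {1..length v}" using propagating_pair_range(2)[OF M] by auto
  show ?thesis
  proof
    assume D: "D \<in> half_diagrams k d n v"
    then have "card (snd ` ?pp) = card {1..length v}" using card by (simp add: half_diagrams_def)
    then have all: "snd ` ?pp = {1..length v}" using sub by (intro card_subset_eq) simp_all
    have "\<exists>a b. ({North a, South (Suc i)}, b) \<in> D \<and> v ! i = Suc b" if i: "i < length v" for i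
    proof -
      obtain l b where l: "(l, b) \<in> D" "South (i + 1) \<in> l" "v ! i = b + 1"
        using D i by (auto simp: half_diagrams_def)
      have "Suc i \<in> snd ` ?pp" using all i by simp
      then obtain a where a: "{North a, South (Suc i)} \<in> Domain D" by (auto simp: mem_propagating_pairs)
      have "l = {North a, South (Suc i)}"
        using l by (intro decorated_same_line[OF True _ a, of _ "South (Suc i)"]) auto
      then show ?thesis using l by auto
    qed
    then show "half_diagram k d n v D" using True by (simp add: half_diagram_def)
  next
    assume D: "half_diagram k d n v D"
    have "card {l \<in> Domain D. propagating l} = length v"
      using half_diagram_souths[OF D] card by simp
    moreover have "\<exists>l b. (l, b) \<in> D \<and> South (i + 1) \<in> l \<and> v ! i = b + 1" if i: "i < length v" for i
    proof -
      obtain a b where "({North a, South (Suc i)}, b) \<in> D" "v ! i = Suc b"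
        using D i by (auto simp: half_diagram_def)
      then show ?thesis by (intro exI[of _ "{North a, South (Suc i)}"] exI[of _ b]) simp
    qed
    ultimately show "D \<in> half_diagrams k d n v"
      using True by (simp add: half_diagrams_def contour_diagrams_iff)
  qed
next
  case False
  then show ?thesis by (simp add: half_diagrams_def half_diagram_def contour_diagrams_iff)
qed

lemma half_diagram_label_unique:
  assumes "half_diagram k d n v D" "half_diagram k d n v' D"
  shows "v = v'"
proof (rule nth_equalityI)
  have "card (snd ` propagating_pairs (Domain D)) = length v"
    unfolding half_diagram_souths[OF assms(1)] by simp
  moreover have "card (snd ` propagating_pairs (Domain D)) = length v'"
    unfolding half_diagram_souths[OF assms(2)] by simp
  ultimately show len: "length v = length v'" by simp
  fix i assume i: "i < length v"
  have dec: "decorated k d before (points n (length v)) D" using assms by (simp add: half_diagram_def)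
  obtain a b a' b' where D: "({North a, South (Suc i)}, b) \<in> D" "v ! i = Suc b"
    "({North a', South (Suc i)}, b') \<in> D" "v' ! i = Suc b'"
    using assms i len unfolding half_diagram_def by metis
  have "{North a, South (Suc i)} = {North a', South (Suc i)}"
    using D by (intro decorated_same_line[OF dec, of _ _ "South (Suc i)"]) auto
  then show "v ! i = v' ! i" using D decorated_same_blobs[OF dec] by auto
qed

text \<open>A line around the propagating line at southern point \<open>i + 1\<close> must have an end further
  left on the southern edge.  If all the \<open>i\<close> points there end propagating lines, these are
  exactly the lines around it.\<close>

lemma card_enclosing_propagating:
  assumes M: "planar_matching before (points n m) P"
    and line: "{North a, South (Suc i)} \<in> P"
    and left: "{1..i} \<subseteq> snd ` propagating_pairs P"
  shows "card (enclosing before P {North a, South (Suc i)}) = i"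
proof -
  let ?L = "\<lambda>(i, j). {North i, South j}" and ?A = "{x \<in> propagating_pairs P. snd x \<le> i}"
  have "enclosing before P {North a, South (Suc i)} = ?L ` ?A"
  proof (intro equalityI subsetI)
    fix l assume "l \<in> enclosing before P {North a, South (Suc i)}"
    then obtain x y where l: "l \<in> P" "x \<in> l" "y \<in> l" "before (South (Suc i)) y"
      by (auto simp: enclosing_def)
    then obtain s where s: "y = South s" "s \<le> i" by (cases y) auto
    have "y \<in> points n m" using planar_matching_line(1)[OF M l(1)] l(3) by auto
    then have "s \<in> {1..i}" using s by (auto simp: points_def)
    then obtain a' where a': "(a', s) \<in> propagating_pairs P" using left by force
    then have "l = {North a', South s}"
      using l s by (intro planar_matching_same_line[OF M, of _ _ y]) (auto simp: mem_propagating_pairs)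
    then show "l \<in> ?L ` ?A" using a' s by force
  next
    fix l assume "l \<in> ?L ` ?A"
    then obtain a' s where a': "l = {North a', South s}" "(a', s) \<in> propagating_pairs P" "s \<le> i" by auto
    then have "a' < a"
      using propagating_pair_order[OF M a'(2), of a "Suc i"] line by (simp add: mem_propagating_pairs)
    then show "l \<in> enclosing before P {North a, South (Suc i)}"
      using a' unfolding enclosing_def mem_propagating_pairs
      by (auto intro!: bexI[of _ "North a'"] bexI[of _ "South s"])
  qed
  moreover have "card (?L ` ?A) = card ?A" by (rule card_image[OF inj_on_pair_line])
  moreover have "card ?A = card (snd ` ?A)"
    by (rule card_image[symmetric], rule inj_on_subset[OF inj_on_snd_propagating_pairs[OF M]]) auto
  moreover have "snd ` ?A = {1..i}"
    using left propagating_pair_range(2)[OF M] by force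
  ultimately show ?thesis by simp
qed

lemma half_diagram_label_in_verts:
  assumes "half_diagram k d n v D"
  shows "v \<in> verts (contour_tree k d)"
proof -
  have dec: "decorated k d before (points n (length v)) D" using assms by (simp add: half_diagram_def)
  have "1 \<le> v ! i \<and> v ! i \<le> (if i < k then d else 1)" if i: "i < length v" for i
  proof -
    obtain a b where ab: "({North a, South (Suc i)}, b) \<in> D" "v ! i = Suc b"
      using assms i unfolding half_diagram_def by metis
    have "card (enclosing before (Domain D) {North a, South (Suc i)}) = i"
      using ab i half_diagram_souths[OF assms]
      by (intro card_enclosing_propagating[OF decorated_matching[OF dec]]) auto
    then show ?thesis using decorated_blobs[OF dec ab(1)] ab(2) by (simp split: if_splits)
  qed
  then show ?thesis by (simp add: contour_tree_def)
qed

section \<open>The Pascal array of half-diagrams\<close>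

lemma crossing_free_insert_innermost:
  assumes "crossing_free r P"
    "\<And>x y p. x \<in> l \<Longrightarrow> y \<in> l \<Longrightarrow> p \<in> \<Union>P \<union> l \<Longrightarrow> \<not> (r x p \<and> r p y)"
  shows "crossing_free r (insert l P)"
proof -
  have False if "h \<in> insert l P" "h' \<in> insert l P" "a \<in> h" "b \<in> h'" "a' \<in> h" "b' \<in> h'"
    "r a b" "r b a'" "r a' b'" for h h' a b a' b'
  proof (cases "h = l \<or> h' = l")
    case True
    then show False using assms(2)[of a a' b] assms(2)[of b b' a'] that by blast
  next
    case False
    then have "h \<in> P" "h' \<in> P" using that by auto
    then show False using assms(1) that(3-) unfolding crossing_free_def by blast
  qed
  then show ?thesis unfolding crossing_free_def by blast
qed

lemma enclosing_insert_innermost: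
  assumes "\<And>x y p. x \<in> l \<Longrightarrow> y \<in> l \<Longrightarrow> p \<in> h \<Longrightarrow> \<not> (r x p \<and> r p y)" "h \<noteq> {}"
  shows "enclosing r (insert l P) h = enclosing r P h"
proof -
  obtain p where "p \<in> h" using assms(2) by blast
  then have "\<not> (\<exists>a\<in>l. \<exists>b\<in>l. \<forall>c\<in>h. r a c \<and> r c b)" using assms(1) by blast
  then show ?thesis unfolding enclosing_def by blast
qed

text \<open>The last northern and the last southern point are neighbours in the boundary order, so a line
  joining them encloses nothing and crosses nothing.\<close>

lemma last_line_innermost:
  assumes "x \<in> {North (Suc n), South (Suc j)}" "y \<in> {North (Suc n), South (Suc j)}"
    "p \<in> points (Suc n) (Suc j)"
  shows "\<not> (before x p \<and> before p y)"
  using assms by (auto simp: points_def)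

lemma points_Suc: "points (Suc n) (Suc j) = {North (Suc n), South (Suc j)} \<union> points n j"
  by (auto simp: points_def image_Un atLeastAtMostSuc_conv)

lemma last_line_fresh: "{North (Suc n), South (Suc j)} \<inter> points n j = {}"
  by (auto simp: points_def)

text \<open>The new line is innermost, so the old lines keep their depths; all the old propagating lines,
  and no others, are around it, so the label may be extended by \<open>x\<close> if the new line may carry
  \<open>x - 1\<close> blobs.\<close>

lemma half_diagram_insert_line:
  assumes D: "half_diagram k d n v D" and x: "1 \<le> x" "x \<le> (if length v < k then d else 1)"
  shows "half_diagram k d (Suc n) (v @ [x])
    (insert ({North (Suc n), South (Suc (length v))}, x - 1) D)"
proof -
  let ?l = "{North (Suc n), South (Suc (length v))}" and ?P = "Domain D"
  let ?D = "insert (?l, x - 1) D"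
  note dec = half_diagram_decorated[OF D]
  have fresh: "?l \<inter> l = {}" if "l \<in> ?P" for l
    using decorated_line(1)[OF dec that] last_line_fresh[of n "length v"] by blast
  have innermost: "\<not> (before a p \<and> before p b)" if "a \<in> ?l" "b \<in> ?l" "p \<in> \<Union>?P \<union> ?l" for a b p
    using that last_line_innermost[of a n "length v" b p]
    unfolding decorated_points[OF dec] points_Suc by blast
  have P: "Domain ?D = insert ?l ?P" by simp
  have matching: "planar_matching before (points (Suc n) (Suc (length v))) (insert ?l ?P)"
  proof (rule planar_matchingI)
    show "\<Union>(insert ?l ?P) = points (Suc n) (Suc (length v))"
      unfolding points_Suc Union_insert decorated_points[OF dec] ..
    show "l = l'" if "l \<in> insert ?l ?P" "l' \<in> insert ?l ?P" "p \<in> l" "p \<in> l'" for l l' p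
      using that fresh decorated_same_line[OF dec] by blast
    show "card l = 2" if "l \<in> insert ?l ?P" for l
      using that decorated_line(2)[OF dec] by auto
    show "crossing_free before (insert ?l ?P)"
      using decorated_matching[OF dec] innermost
      by (intro crossing_free_insert_innermost) (simp_all add: planar_matching_def)
  qed
  have old: "enclosing before (insert ?l ?P) l = enclosing before ?P l" if "l \<in> ?P" for l
  proof (rule enclosing_insert_innermost)
    show "l \<noteq> {}" using decorated_line(2)[OF dec that] by auto
    show "\<not> (before a p \<and> before p b)" if "a \<in> ?l" "b \<in> ?l" "p \<in> l" for a b p
      using innermost that \<open>l \<in> ?P\<close> by blast
  qed
  have new: "card (enclosing before (insert ?l ?P) ?l) = length v"
  proof (rule card_enclosing_propagating[OF matching])
    have "propagating_pairs ?P \<subseteq> propagating_pairs (insert ?l ?P)"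
      by (auto simp: propagating_pairs_def)
    then show "{1..length v} \<subseteq> snd ` propagating_pairs (insert ?l ?P)"
      using half_diagram_souths[OF D] by blast
  qed simp
  have "decorated k d before (points (Suc n) (Suc (length v))) ?D"
  proof (rule decoratedI)
    show "planar_matching before (points (Suc n) (Suc (length v))) (Domain ?D)"
      unfolding P by (rule matching)
    have lD: "?l \<notin> ?P" using fresh[of ?l] by auto
    show "b = b'" if "(l, b) \<in> ?D" "(l, b') \<in> ?D" for l b b'
      using that lD decorated_same_blobs[OF dec] by auto
    show "if card (enclosing before (Domain ?D) l) < k then b < d else b = 0" if "(l, b) \<in> ?D" for l b
    proof (cases "l = ?l")
      case True
      then have "b = x - 1" using that lD by auto
      then show ?thesis unfolding P True new using x by (auto split: if_splits)
    next
      case False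
      then have "(l, b) \<in> D" using that by simp
      then show ?thesis unfolding P using old[OF DomainI] decorated_blobs[OF dec] by simp
    qed
  qed
  moreover have "\<exists>a b. ({North a, South (Suc i)}, b) \<in> ?D \<and> (v @ [x]) ! i = Suc b"
    if i: "i < Suc (length v)" for i
  proof (cases "i < length v")
    case True
    then obtain a b where "({North a, South (Suc i)}, b) \<in> D" "v ! i = Suc b"
      using D unfolding half_diagram_def by blast
    then show ?thesis using True by (auto simp: nth_append)
  next
    case False
    then have "i = length v" using i by simp
    then show ?thesis using x by (intro exI[of _ "Suc n"] exI[of _ "x - 1"]) simp
  qed
  ultimately show ?thesis by (simp add: half_diagram_def)
qed

text \<open>Moving the last southern point to the end of the northern edge, and back.  The point keeps
  its rank in the boundary order.\<close>

definition bend_up :: "nat \<Rightarrow> nat \<Rightarrow> point \<Rightarrow> point" where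
  "bend_up n j p = (if p = South j then North n else p)"

definition bend_down :: "nat \<Rightarrow> nat \<Rightarrow> point \<Rightarrow> point" where
  "bend_down n j p = (if p = North n then South j else p)"

lemma before_bend_up:
  assumes "p \<in> points n (Suc j)" "q \<in> points n (Suc j)"
  shows "before (bend_up (Suc n) (Suc j) p) (bend_up (Suc n) (Suc j) q) = before p q"
  using assms by (cases p; cases q) (auto simp: bend_up_def points_def)

lemma before_bend_down:
  assumes "p \<in> points (Suc n) j" "q \<in> points (Suc n) j"
  shows "before (bend_down (Suc n) (Suc j) p) (bend_down (Suc n) (Suc j) q) = before p q"
  using assms by (cases p; cases q) (auto simp: bend_down_def points_def)

lemma bend_down_up: "p \<in> points n (Suc j) \<Longrightarrow> bend_down (Suc n) (Suc j) (bend_up (Suc n) (Suc j) p) = p"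
  by (auto simp: bend_up_def bend_down_def points_def)

lemma bend_up_down: "p \<in> points (Suc n) j \<Longrightarrow> bend_up (Suc n) (Suc j) (bend_down (Suc n) (Suc j) p) = p"
  by (auto simp: bend_up_def bend_down_def points_def)

lemma bend_up_points: "bend_up (Suc n) (Suc j) ` points n (Suc j) = points (Suc n) j"
  by (force simp: bend_up_def points_def image_iff)

lemma bend_down_points: "bend_down (Suc n) (Suc j) ` points (Suc n) j = points n (Suc j)"
  by (force simp: bend_down_def points_def image_iff)

lemma decorated_bend_up:
  assumes "decorated k d before (points n (Suc j)) D"
  shows "decorated k d before (points (Suc n) j) (relabel (bend_up (Suc n) (Suc j)) D)"
proof -
  have "inj_on (bend_up (Suc n) (Suc j)) (points n (Suc j))"
    by (rule inj_on_inverseI[of _ "bend_down (Suc n) (Suc j)"]) (rule bend_down_up)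
  from decorated_relabel[OF assms this before_bend_up] show ?thesis unfolding bend_up_points .
qed

lemma decorated_bend_down:
  assumes "decorated k d before (points (Suc n) j) D"
  shows "decorated k d before (points n (Suc j)) (relabel (bend_down (Suc n) (Suc j)) D)"
proof -
  have "inj_on (bend_down (Suc n) (Suc j)) (points (Suc n) j)"
    by (rule inj_on_inverseI[of _ "bend_up (Suc n) (Suc j)"]) (rule bend_up_down)
  from decorated_relabel[OF assms this before_bend_down] show ?thesis unfolding bend_down_points .
qed

lemma relabel_bend_down_up:
  assumes "decorated k d before (points n (Suc j)) D"
  shows "relabel (bend_down (Suc n) (Suc j)) (relabel (bend_up (Suc n) (Suc j)) D) = D"
  unfolding relabel_relabel by (rule relabel_ident) (simp add: decorated_points[OF assms] bend_down_up)

lemma relabel_bend_up_down: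
  assumes "decorated k d before (points (Suc n) j) D"
  shows "relabel (bend_up (Suc n) (Suc j)) (relabel (bend_down (Suc n) (Suc j)) D) = D"
  unfolding relabel_relabel by (rule relabel_ident) (simp add: decorated_points[OF assms] bend_up_down)

lemma half_diagram_bend_up:
  assumes D: "half_diagram k d n (v @ [x]) D"
  shows "half_diagram k d (Suc n) v (relabel (bend_up (Suc n) (Suc (length v))) D)"
proof -
  let ?f = "bend_up (Suc n) (Suc (length v))"
  have "\<exists>a b. ({North a, South (Suc i)}, b) \<in> relabel ?f D \<and> v ! i = Suc b" if i: "i < length v" for i
  proof -
    have "i < length (v @ [x])" "(v @ [x]) ! i = v ! i" using i by (simp_all add: nth_append)
    then obtain a b where ab: "({North a, South (Suc i)}, b) \<in> D" "v ! i = Suc b"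
      using D unfolding half_diagram_def by metis
    moreover have "?f ` {North a, South (Suc i)} = {North a, South (Suc i)}"
      using i by (simp add: bend_up_def)
    ultimately show ?thesis using mem_relabelI[OF ab(1), of ?f] by auto
  qed
  moreover have "decorated k d before (points n (Suc (length v))) D"
    using half_diagram_decorated[OF D] by simp
  ultimately show ?thesis by (simp add: half_diagram_def decorated_bend_up)
qed

text \<open>If the last northern point ends a propagating line, this is the last propagating line by
  \<open>propagating_pair_order\<close>.  Otherwise it is the right end of a cap.\<close>

lemma half_diagram_last_north:
  assumes D: "half_diagram k d (Suc n) v D"
  obtains b where "v \<noteq> []" "({North (Suc n), South (length v)}, b) \<in> D"
  | a b where "({North a, North (Suc n)}, b) \<in> D"
proof -
  note dec = half_diagram_decorated[OF D]
  have "North (Suc n) \<in> \<Union>(Domain D)" unfolding decorated_points[OF dec] by (simp add: points_def)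
  then obtain l b where l: "(l, b) \<in> D" "North (Suc n) \<in> l" by auto
  then have lD: "l \<in> Domain D" by auto
  from decorated_line(2)[OF dec lD] l(2) obtain p where p: "l = {North (Suc n), p}"
    by (auto simp: card_2_iff)
  show thesis
  proof (cases p)
    case (North a)
    then show ?thesis using that(2) l p by (metis insert_commute)
  next
    case (South s)
    have s: "s \<in> {1..length v}"
      using decorated_line(1)[OF dec lD] p South by (auto simp: points_def)
    then have "length v \<in> snd ` propagating_pairs (Domain D)"
      using half_diagram_souths[OF D] by auto
    then obtain a where a: "(a, length v) \<in> propagating_pairs (Domain D)" by auto
    have "\<not> Suc n < a" using propagating_pair_range(1)[OF half_diagram_matching[OF D] a] by simp
    then have "\<not> s < length v"
      using propagating_pair_order[OF half_diagram_matching[OF D] _ a, of "Suc n" s] lD p South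
      by (simp add: mem_propagating_pairs)
    then have "s = length v" using s by simp
    moreover have "v \<noteq> []" using s by auto
    ultimately show ?thesis using that(1)[of b] l p South by simp
  qed
qed

text \<open>Inverse of \<open>half_diagram_insert_line\<close>: an innermost line is around no other line, so it
  can be taken away.\<close>

lemma half_diagram_remove_line:
  assumes D: "half_diagram k d (Suc n) (v @ [x]) D"
    and l: "({North (Suc n), South (Suc (length v))}, b) \<in> D"
  shows "x = Suc b" "half_diagram k d n v (D - {({North (Suc n), South (Suc (length v))}, b)})"
proof -
  let ?l = "{North (Suc n), South (Suc (length v))}"
  let ?D = "D - {(?l, b)}"
  have dec: "decorated k d before (points (Suc n) (Suc (length v))) D"
    using half_diagram_decorated[OF D] by simp
  obtain a b' where ab: "({North a, South (Suc (length v))}, b') \<in> D" "x = Suc b'"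
    using D unfolding half_diagram_def by (metis length_append_singleton lessI nth_append_length)
  have "{North a, South (Suc (length v))} = ?l"
    using ab(1) l by (intro decorated_same_line[OF dec, of _ _ "South (Suc (length v))"]) auto
  then show "x = Suc b" using decorated_same_blobs[OF dec] ab l by auto
  have P: "Domain ?D = Domain D - {?l}"
    using l decorated_same_blobs[OF dec] by auto
  have "\<Union>(Domain ?D) = points n (length v)"
  proof -
    have "?l \<inter> h = {}" if "h \<in> Domain D" "h \<noteq> ?l" for h
      using decorated_same_line[OF dec that(1), of ?l] l that by blast
    then have "\<Union>(Domain D - {?l}) = \<Union>(Domain D) - ?l" by blast
    also have "\<dots> = points n (length v)"
      using last_line_fresh[of n "length v"] unfolding decorated_points[OF dec] points_Suc by blast
    finally show ?thesis unfolding P .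
  qed
  moreover have "decorated k d before (\<Union>(Domain ?D)) ?D"
  proof (rule decorated_sub[OF dec])
    show "enclosing before (Domain D) h \<subseteq> Domain ?D" if "h \<in> Domain ?D" for h
    proof -
      have h: "h \<in> Domain D" using that P by auto
      then obtain p where "p \<in> h" using decorated_line(2)[OF dec h] by (auto simp: card_2_iff)
      then have "p \<in> points (Suc n) (Suc (length v))" using decorated_line(1)[OF dec h] by auto
      then have "?l \<notin> enclosing before (Domain D) h"
        using last_line_innermost[of _ n "length v" _ p] \<open>p \<in> h\<close> unfolding enclosing_def by blast
      then show ?thesis unfolding P by (auto simp: enclosing_def)
    qed
  qed auto
  moreover have "\<exists>a b'. ({North a, South (Suc i)}, b') \<in> ?D \<and> v ! i = Suc b'" if i: "i < length v" for i
  proof -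
    have "i < length (v @ [x])" "(v @ [x]) ! i = v ! i" using i by (simp_all add: nth_append)
    then obtain a b where "({North a, South (Suc i)}, b) \<in> D" "v ! i = Suc b"
      using D unfolding half_diagram_def by metis
    then show ?thesis using i by auto
  qed
  ultimately show "half_diagram k d n v ?D" by (simp add: half_diagram_def)
qed

text \<open>Inverse of \<open>half_diagram_bend_up\<close>: the cap over the last northern point becomes the
  last propagating line, and its blobs become the last entry of the label.\<close>

lemma half_diagram_bend_down:
  assumes D: "half_diagram k d (Suc n) v D" and cap: "({North a, North (Suc n)}, b) \<in> D"
  shows "half_diagram k d n (v @ [Suc b]) (relabel (bend_down (Suc n) (Suc (length v))) D)"
proof -
  let ?f = "bend_down (Suc n) (Suc (length v))"
  note dec = half_diagram_decorated[OF D]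
  have capD: "{North a, North (Suc n)} \<in> Domain D" using cap by auto
  have "a \<noteq> Suc n" using decorated_line(2)[OF dec capD] by auto
  then have "?f ` {North a, North (Suc n)} = {North a, South (Suc (length v))}"
    by (simp add: bend_down_def)
  then have new: "({North a, South (Suc (length v))}, b) \<in> relabel ?f D"
    using mem_relabelI[OF cap, of ?f] by simp
  have "\<exists>a b'. ({North a, South (Suc i)}, b') \<in> relabel ?f D \<and> (v @ [Suc b]) ! i = Suc b'"
    if i: "i < Suc (length v)" for i
  proof (cases "i < length v")
    case True
    then obtain a' b' where ab: "({North a', South (Suc i)}, b') \<in> D" "v ! i = Suc b'"
      using D unfolding half_diagram_def by metis
    have "a' \<noteq> Suc n"
    proof
      assume "a' = Suc n"
      then have "{North a', South (Suc i)} = {North a, North (Suc n)}"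
        using ab(1) cap by (intro decorated_same_line[OF dec, of _ _ "North (Suc n)"]) auto
      then show False by (auto simp: doubleton_eq_iff)
    qed
    then have "?f ` {North a', South (Suc i)} = {North a', South (Suc i)}"
      by (simp add: bend_down_def)
    then have "({North a', South (Suc i)}, b') \<in> relabel ?f D" using mem_relabelI[OF ab(1), of ?f] by simp
    then show ?thesis using ab(2) True by (auto simp: nth_append)
  next
    case False
    then have "i = length v" using i by simp
    then show ?thesis using new by (auto simp: nth_append)
  qed
  then show ?thesis using decorated_bend_down[OF dec] by (simp add: half_diagram_def)
qed

lemma contour_tree_simps:
  "tail (contour_tree k d) = fst" "head (contour_tree k d) = snd"
  "(u, v) \<in> arcs (contour_tree k d) \<longleftrightarrow> u \<in> verts (contour_tree k d) \<and>
    v \<in> verts (contour_tree k d) \<and> (\<exists>x. v = u @ [x] \<or> u = v @ [x])"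
  by (auto simp: contour_tree_def Let_def)

lemma contour_tree_last_label:
  assumes "u @ [x] \<in> verts (contour_tree k d)"
  shows "1 \<le> x" "x \<le> (if length u < k then d else 1)"
proof -
  have "1 \<le> (u @ [x]) ! i \<and> (u @ [x]) ! i \<le> (if i < k then d else 1)" if "i < Suc (length u)" for i
    using assms that by (simp add: contour_tree_def Let_def)
  from this[of "length u"] show "1 \<le> x" "x \<le> (if length u < k then d else 1)" by auto
qed

text \<open>The edge maps: along an arc away from the root a propagating line is inserted at the right,
  and along an arc towards the root the last propagating line is bent up to the new northern point.\<close>

definition add_north :: "nat \<Rightarrow> nat list \<times> nat list \<Rightarrow> diagram \<Rightarrow> diagram" where
  "add_north n = (\<lambda>(u, v) D.
     if length u < length v then insert ({North n, South (length v)}, last v - 1) D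
     else relabel (bend_up n (length u)) D)"

lemma add_north_simps:
  "add_north n (u, u @ [x]) D = insert ({North n, South (Suc (length u))}, x - 1) D"
  "add_north n (v @ [x], v) D = relabel (bend_up n (Suc (length v))) D"
  by (simp_all add: add_north_def)

lemma half_diagram_add_north:
  assumes "(u, v) \<in> arcs (contour_tree k d)" "half_diagram k d n u D"
  shows "half_diagram k d (Suc n) v (add_north (Suc n) (u, v) D)"
proof -
  have v: "v \<in> verts (contour_tree k d)" using assms by (simp add: contour_tree_simps)
  obtain x where "v = u @ [x] \<or> u = v @ [x]" using assms by (auto simp: contour_tree_simps)
  then show ?thesis
  proof
    assume "v = u @ [x]"
    then show ?thesis
      using half_diagram_insert_line[OF assms(2)] contour_tree_last_label[of u x k d] v
      by (simp add: add_north_simps)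
  next
    assume "u = v @ [x]"
    then show ?thesis using half_diagram_bend_up assms(2) by (simp add: add_north_simps)
  qed
qed

lemma half_diagram_from_add_north:
  assumes D: "half_diagram k d (Suc n) v D"
  obtains u E where "(u, v) \<in> arcs (contour_tree k d)" "half_diagram k d n u E"
    "D = add_north (Suc n) (u, v) E"
proof -
  have v: "v \<in> verts (contour_tree k d)" by (rule half_diagram_label_in_verts[OF D])
  from D show thesis
  proof (cases rule: half_diagram_last_north)
    case (1 b)
    then obtain u x where u: "v = u @ [x]" by (metis rev_exhaust)
    have l: "({North (Suc n), South (Suc (length u))}, b) \<in> D" using 1 u by simp
    have "half_diagram k d (Suc n) (u @ [x]) D" using D u by simp
    note E = half_diagram_remove_line[OF this l]
    show thesis
    proof (rule that)
      show "half_diagram k d n u (D - {({North (Suc n), South (Suc (length u))}, b)})" by (rule E)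
      show "(u, v) \<in> arcs (contour_tree k d)"
        using v half_diagram_label_in_verts[OF E(2)] u by (simp add: contour_tree_simps)
      show "D = add_north (Suc n) (u, v) (D - {({North (Suc n), South (Suc (length u))}, b)})"
        unfolding u add_north_simps E(1) using l by auto
    qed
  next
    case (2 a b)
    note E = half_diagram_bend_down[OF D 2]
    show thesis
    proof (rule that[OF _ E])
      show "(v @ [Suc b], v) \<in> arcs (contour_tree k d)"
        using v half_diagram_label_in_verts[OF E] by (simp add: contour_tree_simps)
      show "D = add_north (Suc n) (v @ [Suc b], v) (relabel (bend_down (Suc n) (Suc (length v))) D)"
        unfolding add_north_simps using relabel_bend_up_down[OF half_diagram_decorated[OF D]] by simp
    qed
  qed
qed

lemma half_diagram_no_north:
  assumes "half_diagram k d n u E"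
  shows "l \<in> Domain E \<Longrightarrow> North (Suc n) \<notin> l"
  using decorated_line(1)[OF half_diagram_decorated[OF assms]] by (force simp: points_def)

text \<open>The arc can be read off from the result: the line at the new northern point is propagating
  iff the arc leads away from the root, and if it leads towards the root, the blobs on the new cap give
  the deleted entry.\<close>

lemma add_north_inj:
  assumes "(u, v) \<in> arcs (contour_tree k d)" "half_diagram k d n u E"
    "(u', v) \<in> arcs (contour_tree k d)" "half_diagram k d n u' E'"
    "add_north (Suc n) (u, v) E = add_north (Suc n) (u', v) E'"
  shows "u = u' \<and> E = E'"
proof -
  \<comment> \<open>a line inserted by an outward arc would have to come from a line of \<open>E'\<close> with two southern ends\<close>
  have mixed: False
    if v: "v = w @ [x]" "w' = v @ [y]" and E: "half_diagram k d n w E" "half_diagram k d n w' E'"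
      and eq: "add_north (Suc n) (w, v) E = add_north (Suc n) (w', v) E'" for w x w' y E E'
  proof -
    have "({North (Suc n), South (length v)}, x - 1) \<in> relabel (bend_up (Suc n) (Suc (length v))) E'"
      using eq unfolding v add_north_simps by (metis insertI1 length_append_singleton)
    then obtain l where l: "bend_up (Suc n) (Suc (length v)) ` l = {North (Suc n), South (length v)}" "(l, x - 1) \<in> E'"
      by (metis mem_relabelE)
    have "North (Suc n) \<notin> l" using half_diagram_no_north[OF E(2)] l(2) by auto
    moreover have "North (Suc n) \<in> bend_up (Suc n) (Suc (length v)) ` l" "South (length v) \<in> bend_up (Suc n) (Suc (length v)) ` l"
      unfolding l(1) by simp_all
    ultimately have "South (Suc (length v)) \<in> l" "South (length v) \<in> l"
      by (auto simp: bend_up_def split: if_splits)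
    moreover have "South (length v) \<noteq> South (Suc (length v))" by simp
    moreover have "card l = 2"
      using decorated_line(2)[OF half_diagram_decorated[OF E(2)]] l(2) by auto
    ultimately have l': "l = {South (length v), South (Suc (length v))}"
      by (auto simp: card_2_iff)
    have "Suc (length v) \<in> snd ` propagating_pairs (Domain E')"
      unfolding half_diagram_souths[OF E(2)] v(2) by simp
    then obtain a where a: "{North a, South (Suc (length v))} \<in> Domain E'"
      by (auto simp: mem_propagating_pairs)
    have "{North a, South (Suc (length v))} = l"
      using a l l' by (intro decorated_same_line[OF half_diagram_decorated[OF E(2)], of _ _ "South (Suc (length v))"]) auto
    then show False using l' by (auto simp: doubleton_eq_iff)
  qed
  obtain x y where x: "v = u @ [x] \<or> u = v @ [x]" and y: "v = u' @ [y] \<or> u' = v @ [y]"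
    using assms(1,3) by (auto simp: contour_tree_simps)
  show ?thesis
  proof (cases "v = u @ [x]")
    case True
    then have "v = u' @ [y]" using y mixed[OF True _ assms(2,4,5)] by blast
    then have u: "u' = u" "y = x" using True by simp_all
    have fresh: "({North (Suc n), South (Suc (length u))}, x - 1) \<notin> E" "({North (Suc n), South (Suc (length u))}, x - 1) \<notin> E'"
      using half_diagram_no_north[OF assms(2)] half_diagram_no_north[OF assms(4)] by auto
    have "insert ({North (Suc n), South (Suc (length u))}, x - 1) E = insert ({North (Suc n), South (Suc (length u))}, x - 1) E'"
      using assms(5) True u by (simp add: add_north_simps)
    then show ?thesis using u fresh by (simp add: insert_ident)
  next
    case False
    then have ux: "u = v @ [x]" using x by simp
    then have uy: "u' = v @ [y]" using y mixed[OF _ ux assms(4,2) assms(5)[symmetric]] by blast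
    have "relabel (bend_up (Suc n) (Suc (length v))) E = relabel (bend_up (Suc n) (Suc (length v))) E'"
      using assms(5) ux uy by (simp add: add_north_simps)
    moreover have "decorated k d before (points n (Suc (length v))) E" "decorated k d before (points n (Suc (length v))) E'"
      using half_diagram_decorated[OF assms(2)] half_diagram_decorated[OF assms(4)] ux uy by simp_all
    ultimately have "E = E'" by (metis relabel_bend_down_up)
    then show ?thesis using half_diagram_label_unique assms(2,4) by blast
  qed
qed

lemma half_diagrams_0:
  "half_diagrams k d 0 [] = {{}}" "v \<noteq> [] \<Longrightarrow> half_diagrams k d 0 v = {}"
proof -
  have "D = {}" if D: "half_diagram k d 0 [] D" for D
  proof -
    have "l = {} \<and> card l = 2" if "l \<in> Domain D" for l
      using decorated_line[OF half_diagram_decorated[OF D] that] by (simp add: points_def)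
    then have "Domain D = {}" by fastforce
    then show ?thesis by auto
  qed
  moreover have "half_diagram k d 0 [] {}"
    by (auto simp: half_diagram_def points_def crossing_free_def intro!: decoratedI planar_matchingI)
  ultimately show "half_diagrams k d 0 [] = {{}}"
    by (intro equalityI subsetI) (simp_all add: half_diagrams_iff)
next
  assume "v \<noteq> []"
  have False if D: "half_diagram k d 0 v D" for D
  proof -
    have "length v \<in> snd ` propagating_pairs (Domain D)"
      unfolding half_diagram_souths[OF D] using \<open>v \<noteq> []\<close> by (cases v) simp_all
    then obtain a where "(a, length v) \<in> propagating_pairs (Domain D)" by auto
    from propagating_pair_range(1)[OF half_diagram_matching[OF D] this] show False by simp
  qed
  then show "half_diagrams k d 0 v = {}" by (auto simp: half_diagrams_iff)
qed

text \<open>The edge maps reach everything by \<open>half_diagram_from_add_north\<close>; that each of them is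
  injective and that their images are disjoint are both contained in \<open>add_north_inj\<close>.\<close>

theorem pascal_array_half_diagrams:
  "pascal_array (contour_tree k d) [] (half_diagrams k d)"
proof -
  let ?G = "contour_tree k d" and ?Y = "half_diagrams k d"
  have edges: "(\<forall>e\<in>arcs ?G. add_north n e ` ?Y (n - 1) (tail ?G e) \<subseteq> ?Y n (head ?G e) \<and>
           inj_on (add_north n e) (?Y (n - 1) (tail ?G e))) \<and>
        (\<forall>v\<in>verts ?G.
           ?Y n v = (\<Union>e\<in>{e \<in> arcs ?G. head ?G e = v}. add_north n e ` ?Y (n - 1) (tail ?G e)) \<and>
           disjoint_family_on (\<lambda>e. add_north n e ` ?Y (n - 1) (tail ?G e)) {e \<in> arcs ?G. head ?G e = v})"
    if n: "n \<ge> 1" for n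
  proof -
    obtain m where m: "n = Suc m" using n by (cases n) auto
    have into: "add_north n e ` ?Y (n - 1) (tail ?G e) \<subseteq> ?Y n (head ?G e)" if "e \<in> arcs ?G" for e
      using half_diagram_add_north[of "fst e" "snd e" k d m] that
      by (auto simp: m half_diagrams_iff contour_tree_simps(1,2))
    moreover have "inj_on (add_north n e) (?Y (n - 1) (tail ?G e))" if "e \<in> arcs ?G" for e
      using add_north_inj[of "fst e" "snd e" k d m _ "fst e"] that
      by (intro inj_onI) (auto simp: m half_diagrams_iff contour_tree_simps(1,2))
    moreover have "?Y n v \<subseteq> (\<Union>e\<in>{e \<in> arcs ?G. head ?G e = v}. add_north n e ` ?Y (n - 1) (tail ?G e))" for v
    proof
      fix D assume "D \<in> ?Y n v"
      then obtain u E where "(u, v) \<in> arcs ?G" "half_diagram k d m u E" "D = add_north (Suc m) (u, v) E"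
        by (auto simp: m half_diagrams_iff elim: half_diagram_from_add_north)
      then show "D \<in> (\<Union>e\<in>{e \<in> arcs ?G. head ?G e = v}. add_north n e ` ?Y (n - 1) (tail ?G e))"
        by (intro UN_I[of "(u, v)"]) (simp_all add: m half_diagrams_iff contour_tree_simps(1,2))
    qed
    moreover have "disjoint_family_on (\<lambda>e. add_north n e ` ?Y (n - 1) (tail ?G e)) {e \<in> arcs ?G. head ?G e = v}" for v
      unfolding disjoint_family_on_def
    proof (intro ballI impI)
      fix e e' assume e: "e \<in> {e \<in> arcs ?G. head ?G e = v}" "e' \<in> {e \<in> arcs ?G. head ?G e = v}" "e \<noteq> e'"
      then obtain u u' where u: "e = (u, v)" "e' = (u', v)" "u \<noteq> u'" "(u, v) \<in> arcs ?G" "(u', v) \<in> arcs ?G"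
        by (cases e; cases e') (auto simp: contour_tree_simps(2))
      have "add_north n e E \<noteq> add_north n e' E'"
        if "E \<in> ?Y (n - 1) (tail ?G e)" "E' \<in> ?Y (n - 1) (tail ?G e')" for E E'
        using add_north_inj[OF u(4) _ u(5), of m E E'] u(1-3) that
        by (auto simp: m half_diagrams_iff contour_tree_simps(1))
      then show "add_north n e ` ?Y (n - 1) (tail ?G e) \<inter> add_north n e' ` ?Y (n - 1) (tail ?G e') = {}" by blast
    qed
    ultimately show ?thesis by (intro conjI ballI equalityI UN_least) auto
  qed
  show ?thesis
    unfolding pascal_array_def
  proof (intro conjI)
    show "\<exists>y. ?Y 0 [] = {y}" using half_diagrams_0(1) by blast
    show "\<forall>v\<in>verts ?G. v \<noteq> [] \<longrightarrow> ?Y 0 v = {}" using half_diagrams_0(2) by blast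
  qed (rule exI[of _ add_north], intro allI impI, erule edges)
qed

section \<open>Cutting a diagram\<close>

lemma decorated_reflect_points:
  "decorated k d before (points n m) (reflect D) \<longleftrightarrow> decorated k d before (points m n) D"
  using decorated_reflect[of k d "points n m" "reflect D"] decorated_reflect[of k d "points m n" D]
  by (auto simp: flip_points)

lemma propagating_flip: "propagating (flip ` l) \<longleftrightarrow> propagating l"
proof -
  have *: "propagating (flip ` l)" if pl: "propagating l" for l
  proof -
    obtain i j where "l = {North i, South j}" using pl by (auto simp: propagating_def)
    then have "flip ` l = {North j, South i}" by auto
    then show ?thesis by (auto simp: propagating_def)
  qed
  have "flip ` flip ` l = l" by (simp add: image_image)
  then show ?thesis using *[of l] *[of "flip ` l"] by auto
qed

text \<open>Reflection preserves depths, exchanges north and south, and keeps left and right.\<close>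

lemma lower_half_diagrams_iff:
  "D \<in> lower_half_diagrams k d n v \<longleftrightarrow> reflect D \<in> half_diagrams k d n v"
proof -
  have inj: "inj flip" by (metis injI flip_flip)
  have "{l \<in> Domain (reflect D). propagating l} = (`) flip ` {l \<in> Domain D. propagating l}"
    unfolding reflect_eq Domain_relabel using propagating_flip by auto
  then have card: "card {l \<in> Domain (reflect D). propagating l} = card {l \<in> Domain D. propagating l}"
    using card_image[OF inj_on_subset[OF inj_on_image_Pow[OF inj]]] by simp
  have ends: "(\<exists>l b. (l, b) \<in> reflect D \<and> South (i + 1) \<in> l \<and> Q b) \<longleftrightarrow>
      (\<exists>l b. (l, b) \<in> D \<and> North (i + 1) \<in> l \<and> Q b)" for i Q
  proof
    assume "\<exists>l b. (l, b) \<in> reflect D \<and> South (i + 1) \<in> l \<and> Q b"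
    then obtain l b where "(flip ` l, b) \<in> D" "South (i + 1) \<in> l" "Q b" by (auto simp: mem_reflect)
    moreover from this have "North (i + 1) \<in> flip ` l" by (intro image_eqI[of _ _ "South (i + 1)"]) simp_all
    ultimately show "\<exists>l b. (l, b) \<in> D \<and> North (i + 1) \<in> l \<and> Q b" by blast
  next
    assume "\<exists>l b. (l, b) \<in> D \<and> North (i + 1) \<in> l \<and> Q b"
    then obtain l b where l: "(l, b) \<in> D" "North (i + 1) \<in> l" "Q b" by blast
    then have "South (i + 1) \<in> flip ` l" by (intro image_eqI[of _ _ "North (i + 1)"]) simp_all
    moreover have "(flip ` l, b) \<in> reflect D" using l(1) by (simp add: mem_reflect image_image)
    ultimately show "\<exists>l b. (l, b) \<in> reflect D \<and> South (i + 1) \<in> l \<and> Q b" using l(3) by blast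
  qed
  show ?thesis
    unfolding lower_half_diagrams_def half_diagrams_def mem_Collect_eq contour_diagrams_iff
      decorated_reflect_points card ends ..
qed

lemma reflected_lower_half_diagrams_eq:
  "reflected_lower_half_diagrams k d = half_diagrams k d"
proof (intro ext equalityI subsetI)
  fix n v D assume "D \<in> half_diagrams k d n v"
  then have "reflect D \<in> lower_half_diagrams k d n v" by (simp add: lower_half_diagrams_iff)
  then show "D \<in> reflected_lower_half_diagrams k d n v"
    unfolding reflected_lower_half_diagrams_def by (rule image_eqI[rotated]) simp
next
  fix n v D assume "D \<in> reflected_lower_half_diagrams k d n v"
  then show "D \<in> half_diagrams k d n v"
    by (auto simp: reflected_lower_half_diagrams_def lower_half_diagrams_iff)
qed

text \<open>For a southern point \<open>j\<close> that ends a propagating line, and \<open>A\<close> the set of all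
  such points, this is the number that \<open>j\<close> gets in the upper half.\<close>

definition rank :: "nat set \<Rightarrow> nat \<Rightarrow> nat" where
  "rank A j = card {j' \<in> A. j' \<le> j}"

lemma rank_less:
  assumes "finite A" "j \<in> A" "i < j"
  shows "rank A i < rank A j"
  unfolding rank_def
proof (rule psubset_card_mono)
  have "j \<in> {j' \<in> A. j' \<le> j} - {j' \<in> A. j' \<le> i}" using assms by simp
  moreover have "{j' \<in> A. j' \<le> i} \<subseteq> {j' \<in> A. j' \<le> j}" using assms by auto
  ultimately show "{j' \<in> A. j' \<le> i} \<subset> {j' \<in> A. j' \<le> j}" by blast
qed (use assms in simp)

lemma rank_less_iff:
  assumes "finite A" "i \<in> A" "j \<in> A"
  shows "rank A i < rank A j \<longleftrightarrow> i < j"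
  using rank_less[of A j i] rank_less[of A i j] assms by (metis less_asym' less_irrefl linorder_neqE_nat)

lemma inj_on_rank: "finite A \<Longrightarrow> inj_on (rank A) A"
  using rank_less by (metis inj_onI less_irrefl linorder_neqE_nat)

lemma rank_image:
  assumes "finite A"
  shows "rank A ` A = {1..card A}"
proof (rule card_subset_eq)
  have "rank A j \<le> card A" for j
    unfolding rank_def using assms by (intro card_mono) auto
  moreover have "1 \<le> rank A j" if "j \<in> A" for j
  proof -
    have "{j' \<in> A. j' \<le> j} \<noteq> {}" using that by auto
    then show ?thesis unfolding rank_def using assms by (simp add: Suc_le_eq card_gt_0_iff)
  qed
  ultimately show "rank A ` A \<subseteq> {1..card A}" by auto
qed (simp_all add: card_image[OF inj_on_rank] assms)

definition north_part :: "diagram \<Rightarrow> diagram" where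
  "north_part D = {(l, b) \<in> D. \<exists>i. North i \<in> l}"

definition straighten :: "nat set \<Rightarrow> point \<Rightarrow> point" where
  "straighten A p = (case p of North i \<Rightarrow> North i | South j \<Rightarrow> South (rank A j))"

lemma straighten_simps [simp]:
  "straighten A (North i) = North i" "straighten A (South j) = South (rank A j)"
  by (simp_all add: straighten_def)

abbreviation souths :: "diagram \<Rightarrow> nat set" where
  "souths D \<equiv> snd ` propagating_pairs (Domain D)"

lemma mem_propagating_souths:
  "(\<exists>l\<in>Domain D. propagating l \<and> South j \<in> l) \<longleftrightarrow> j \<in> souths D"
proof
  assume "\<exists>l\<in>Domain D. propagating l \<and> South j \<in> l"
  then obtain i where "{North i, South j} \<in> Domain D" by (auto simp: propagating_def)
  then show "j \<in> souths D" by (intro image_eqI[of _ _ "(i, j)"]) (simp_all add: mem_propagating_pairs)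
next
  assume "j \<in> souths D"
  then obtain i where "{North i, South j} \<in> Domain D" by (auto simp: mem_propagating_pairs)
  then show "\<exists>l\<in>Domain D. propagating l \<and> South j \<in> l"
    by (intro bexI[of _ "{North i, South j}"]) (auto simp: propagating_def)
qed

lemma mem_propagating_norths:
  "(\<exists>l\<in>Domain D. propagating l \<and> North i \<in> l) \<longleftrightarrow> i \<in> fst ` propagating_pairs (Domain D)"
proof
  assume "\<exists>l\<in>Domain D. propagating l \<and> North i \<in> l"
  then obtain j where "{North i, South j} \<in> Domain D" by (auto simp: propagating_def)
  then show "i \<in> fst ` propagating_pairs (Domain D)"
    by (intro image_eqI[of _ _ "(i, j)"]) (simp_all add: mem_propagating_pairs)
next
  assume "i \<in> fst ` propagating_pairs (Domain D)"
  then obtain j where "{North i, South j} \<in> Domain D" by (auto simp: mem_propagating_pairs)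
  then show "\<exists>l\<in>Domain D. propagating l \<and> North i \<in> l"
    by (intro bexI[of _ "{North i, South j}"]) (auto simp: propagating_def)
qed

lemma upper_half_eq: "upper_half D = relabel (straighten (souths D)) (north_part D)"
proof -
  have "card {j'. j' \<le> j \<and> (\<exists>l\<in>Domain D. propagating l \<and> South j' \<in> l)} = rank (souths D) j" for j
    unfolding mem_propagating_souths rank_def by (rule arg_cong[where f = card]) auto
  then show ?thesis unfolding upper_half_def straighten_def north_part_def by simp
qed

lemma souths_reflect: "souths (reflect D) = fst ` propagating_pairs (Domain D)"
proof -
  have "(i, j) \<in> propagating_pairs (Domain (reflect D)) \<longleftrightarrow> (j, i) \<in> propagating_pairs (Domain D)" for i j
    unfolding mem_propagating_pairs using mem_reflect_pair by blast
  then show ?thesis by force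
qed

lemma reflect_north_part_reflect: "reflect (north_part (reflect D)) = {(l, b) \<in> D. \<exists>j. South j \<in> l}"
proof -
  have "(\<exists>i. North i \<in> flip ` l) \<longleftrightarrow> (\<exists>j. South j \<in> l)" for l
  proof
    assume "\<exists>i. North i \<in> flip ` l"
    then obtain i p where "p \<in> l" "North i = flip p" by auto
    then show "\<exists>j. South j \<in> l" by (cases p) auto
  qed (metis flip_simps(2) imageI)
  then show ?thesis
    by (auto simp: mem_reflect north_part_def image_image)
qed

text \<open>By this identity the results on upper halves also apply to lower halves.\<close>

lemma reflect_lower_half: "reflect (lower_half D) = upper_half (reflect D)"
proof -
  let ?g = "\<lambda>p. case p of North i \<Rightarrow> North (rank (souths (reflect D)) i) | South j \<Rightarrow> South j"
  have "card {i'. i' \<le> i \<and> (\<exists>l\<in>Domain D. propagating l \<and> North i' \<in> l)} = rank (souths (reflect D)) i" for i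
    unfolding mem_propagating_norths souths_reflect rank_def by (rule arg_cong[where f = card]) auto
  then have "lower_half D = relabel ?g (reflect (north_part (reflect D)))"
    unfolding lower_half_def reflect_north_part_reflect by simp
  then have "reflect (lower_half D) = relabel (flip \<circ> ?g \<circ> flip) (north_part (reflect D))"
    unfolding reflect_eq relabel_relabel comp_assoc by (simp only: relabel_relabel comp_assoc)
  also have "flip \<circ> ?g \<circ> flip = straighten (souths (reflect D))"
    by (rule ext) (simp add: flip_def straighten_def split: point.split)
  finally show ?thesis by (simp add: upper_half_eq)
qed

lemma Domain_north_part: "Domain (north_part D) = {l \<in> Domain D. \<exists>i. North i \<in> l}"
  by (auto simp: north_part_def)

lemma before_North: "before p (North i) \<Longrightarrow> \<exists>i'. p = North i'"
  by (cases p) auto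

lemma before_South: "before (South j) p \<Longrightarrow> \<exists>j'. p = South j'"
  by (cases p) auto

lemma mixed_line:
  assumes "planar_matching r S P" "l \<in> P" "North i \<in> l" "South j \<in> l"
  shows "l = {North i, South j}"
proof -
  obtain x y where "l = {x, y}" using planar_matching_line(2)[OF assms(1,2)] by (auto simp: card_2_iff)
  then show ?thesis using assms(3,4) by auto
qed

lemma north_part_points:
  assumes dec: "decorated k d before (points n m) D"
  shows "\<Union>(Domain (north_part D)) = North ` {1..n} \<union> South ` souths D"
proof (intro equalityI subsetI)
  fix p assume "p \<in> \<Union>(Domain (north_part D))"
  then obtain l i where l: "l \<in> Domain D" "North i \<in> l" "p \<in> l" by (auto simp: Domain_north_part)
  show "p \<in> North ` {1..n} \<union> South ` souths D"
  proof (cases p)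
    case (North i)
    then show ?thesis using decorated_line(1)[OF dec l(1)] l(3) by (auto simp: points_def)
  next
    case (South j)
    then have "(i, j) \<in> propagating_pairs (Domain D)"
      using mixed_line[OF decorated_matching[OF dec] l(1,2)] l by (simp add: mem_propagating_pairs)
    then show ?thesis using South by force
  qed
next
  fix p assume "p \<in> North ` {1..n} \<union> South ` souths D"
  then show "p \<in> \<Union>(Domain (north_part D))"
  proof
    assume p: "p \<in> North ` {1..n}"
    then have "p \<in> \<Union>(Domain D)" unfolding decorated_points[OF dec] by (auto simp: points_def)
    then show ?thesis using p unfolding Domain_north_part by blast
  next
    assume "p \<in> South ` souths D"
    then obtain i j where "p = South j" "{North i, South j} \<in> Domain D"
      by (auto simp: mem_propagating_pairs)
    then show ?thesis unfolding Domain_north_part by (intro UnionI[of "{North i, South j}"]) auto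
  qed
qed

text \<open>A line around one with a northern end \<open>i\<close> has a point before \<open>North i\<close> in the
  boundary order, which is again northern.\<close>

lemma decorated_north_part:
  assumes dec: "decorated k d before (points n m) D"
  shows "decorated k d before (North ` {1..n} \<union> South ` souths D) (north_part D)"
  unfolding north_part_points[OF dec, symmetric]
proof (rule decorated_sub[OF dec])
  show "north_part D \<subseteq> D" by (auto simp: north_part_def)
  fix l assume "l \<in> Domain (north_part D)"
  then obtain i where i: "North i \<in> l" by (auto simp: Domain_north_part)
  show "enclosing before (Domain D) l \<subseteq> Domain (north_part D)"
  proof
    fix h assume "h \<in> enclosing before (Domain D) l"
    then obtain a where "h \<in> Domain D" "a \<in> h" "before a (North i)"
      using i unfolding enclosing_def by blast
    then show "h \<in> Domain (north_part D)" using before_North unfolding Domain_north_part by blast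
  qed
qed

text \<open>Taking ranks is an order isomorphism from the southern ends of propagating lines to
  consecutive numbers.\<close>

lemma decorated_upper_half:
  assumes dec: "decorated k d before (points n m) D"
  shows "decorated k d before (points n (card (souths D))) (upper_half D)"
proof -
  let ?S = "North ` {1..n} \<union> South ` souths D"
  have fin: "finite (souths D)"
    using finite_propagating_pairs[OF decorated_matching[OF dec]] by simp
  have mono: "before (straighten (souths D) x) (straighten (souths D) y) = before x y"
    if "x \<in> ?S" "y \<in> ?S" for x y
    using that rank_less_iff[OF fin] by (cases x; cases y) auto
  have "inj_on (straighten (souths D)) ?S"
  proof (rule inj_onI)
    fix x y assume "x \<in> ?S" "y \<in> ?S" "straighten (souths D) x = straighten (souths D) y"
    then show "x = y" using inj_on_eq_iff[OF inj_on_rank[OF fin]] by (cases x; cases y) auto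
  qed
  from decorated_relabel[OF decorated_north_part[OF dec] this, where r' = before, OF mono]
  have "decorated k d before (straighten (souths D) ` ?S) (upper_half D)"
    by (simp add: upper_half_eq)
  also have "straighten (souths D) ` ?S = points n (card (souths D))"
    unfolding points_def rank_image[OF fin, symmetric] by (simp add: image_Un image_image)
  finally show ?thesis .
qed

lemma upper_half_propagating:
  assumes "({North a, South c}, b) \<in> D"
  shows "({North a, South (rank (souths D) c)}, b) \<in> upper_half D"
proof -
  have "({North a, South c}, b) \<in> north_part D" using assms by (auto simp: north_part_def)
  from mem_relabelI[OF this, of "straighten (souths D)"] show ?thesis by (simp add: upper_half_eq)
qed

text \<open>The propagating lines up to a given one are the same, whether they are counted at their
  northern or at their southern ends.\<close>

lemma propagating_ranks_agree:
  assumes dec: "decorated k d before (points n m) D"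
    and ac: "(a, c) \<in> propagating_pairs (Domain D)"
  shows "rank (souths (reflect D)) a = rank (souths D) c"
proof -
  let ?P = "propagating_pairs (Domain D)"
  note M = decorated_matching[OF dec]
  have "rank (souths D) c = card (snd ` {x \<in> ?P. snd x \<le> c})"
    unfolding rank_def by (rule arg_cong[where f = card]) auto
  also have "\<dots> = card {x \<in> ?P. snd x \<le> c}"
    by (rule card_image, rule inj_on_subset[OF inj_on_snd_propagating_pairs[OF M]]) auto
  also have "{x \<in> ?P. snd x \<le> c} = {x \<in> ?P. fst x \<le> a}"
    using propagating_pair_order[OF M ac] by (auto simp: not_less[symmetric])
  also have "card \<dots> = card (fst ` {x \<in> ?P. fst x \<le> a})"
    by (rule card_image[symmetric], rule inj_on_subset[OF inj_on_fst_propagating_pairs[OF M]]) auto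
  also have "\<dots> = rank (souths (reflect D)) a"
    unfolding rank_def souths_reflect by (rule arg_cong[where f = card]) auto
  finally show ?thesis by simp
qed

lemma card_souths_reflect:
  assumes "decorated k d before (points n m) D"
  shows "card (souths (reflect D)) = card (souths D)"
  unfolding souths_reflect
  using card_image[OF inj_on_fst_propagating_pairs[OF decorated_matching[OF assms]]]
    card_image[OF inj_on_snd_propagating_pairs[OF decorated_matching[OF assms]]] by simp

text \<open>Entry \<open>i\<close> of the common label comes from the propagating line of rank \<open>i + 1\<close>,
  which is the same line at the northern and at the southern edge.\<close>

lemma cut_halves:
  assumes dec: "decorated k d before (points n m) D"
  obtains v where "half_diagram k d n v (upper_half D)" "half_diagram k d m v (upper_half (reflect D))"
proof -
  let ?r = "card (souths D)"
  let ?Q = "\<lambda>i x. \<exists>a c b. ({North a, South c}, b) \<in> D \<and> rank (souths D) c = Suc i \<and> x = Suc b"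
  have fin: "finite (souths D)"
    using finite_propagating_pairs[OF decorated_matching[OF dec]] by simp
  have "\<exists>x. ?Q i x" if "i < ?r" for i
  proof -
    have "Suc i \<in> rank (souths D) ` souths D" unfolding rank_image[OF fin] using that by simp
    then obtain a c where "(a, c) \<in> propagating_pairs (Domain D)" "rank (souths D) c = Suc i" by auto
    then show ?thesis unfolding mem_propagating_pairs by blast
  qed
  then obtain v where v: "length v = ?r" "\<forall>i<?r. ?Q i (v ! i)"
    using Skolem_list_nth[of ?r ?Q] by auto
  have "half_diagram k d n v (upper_half D)"
    unfolding half_diagram_def v(1)
  proof (intro conjI allI impI)
    show "decorated k d before (points n ?r) (upper_half D)" by (rule decorated_upper_half[OF dec])
    fix i assume "i < ?r"
    then obtain a c b where "({North a, South c}, b) \<in> D" "rank (souths D) c = Suc i" "v ! i = Suc b"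
      using v(2) by blast
    then show "\<exists>a b. ({North a, South (Suc i)}, b) \<in> upper_half D \<and> v ! i = Suc b"
      using upper_half_propagating[of a c b D] by auto
  qed
  moreover have "half_diagram k d m v (upper_half (reflect D))"
    unfolding half_diagram_def v(1)
  proof (intro conjI allI impI)
    have "decorated k d before (points m n) (reflect D)" using dec by (simp add: decorated_reflect_points)
    from decorated_upper_half[OF this] show "decorated k d before (points m ?r) (upper_half (reflect D))"
      unfolding card_souths_reflect[OF dec] .
    fix i assume "i < ?r"
    then obtain a c b where D: "({North a, South c}, b) \<in> D" "rank (souths D) c = Suc i" "v ! i = Suc b"
      using v(2) by blast
    then have "(a, c) \<in> propagating_pairs (Domain D)" by (auto simp: mem_propagating_pairs)
    then have "rank (souths (reflect D)) a = Suc i" using propagating_ranks_agree[OF dec] D(2) by simp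
    then show "\<exists>a b. ({North a, South (Suc i)}, b) \<in> upper_half (reflect D) \<and> v ! i = Suc b"
      using upper_half_propagating[of c a b "reflect D"] D by (auto simp: mem_reflect_pair)
  qed
  ultimately show thesis by (rule that)
qed

section \<open>Gluing half-diagrams\<close>

text \<open>Here \<open>A\<close> is to contain the lines with a northern end, \<open>B\<close> those with a southern
  end, and the propagating lines belong to both.  A line around a member of \<open>A\<close> has a northern
  end, hence is in \<open>A\<close>, and likewise for \<open>B\<close>; so depths can be computed in \<open>A\<close>
  and \<open>B\<close> separately.  A cap and a cup, which have no common part to refer to, never cross because
  northern points come before southern ones.\<close>

lemma decorated_glue:
  assumes A: "decorated k d before S A" and B: "decorated k d before T B"
    and north: "\<And>l. l \<in> Domain A \<Longrightarrow> \<exists>i. North i \<in> l"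
    and south: "\<And>l. l \<in> Domain B \<Longrightarrow> \<exists>j. South j \<in> l"
    and agree: "\<And>l b i j. North i \<in> l \<Longrightarrow> South j \<in> l \<Longrightarrow> (l, b) \<in> A \<longleftrightarrow> (l, b) \<in> B"
  shows "decorated k d before (S \<union> T) (A \<union> B)"
proof -
  have BA: "l \<in> Domain A" if "l \<in> Domain B" "North i \<in> l" for l i
    using that south[OF that(1)] agree by blast
  have AB: "l \<in> Domain B" if "l \<in> Domain A" "South j \<in> l" for l j
    using that north[OF that(1)] agree by blast
  have eA: "enclosing before (Domain A \<union> Domain B) l = enclosing before (Domain A) l" if l: "l \<in> Domain A" for l
  proof (rule enclosing_sub[symmetric])
    show "enclosing before (Domain A \<union> Domain B) l \<subseteq> Domain A"
    proof
      fix h assume "h \<in> enclosing before (Domain A \<union> Domain B) l"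
      moreover obtain i where "North i \<in> l" using north[OF l] by blast
      ultimately obtain a where "h \<in> Domain A \<union> Domain B" "a \<in> h" "before a (North i)"
        unfolding enclosing_def by blast
      then show "h \<in> Domain A" using before_North BA by blast
    qed
  qed simp
  have eB: "enclosing before (Domain A \<union> Domain B) l = enclosing before (Domain B) l" if l: "l \<in> Domain B" for l
  proof (rule enclosing_sub[symmetric])
    show "enclosing before (Domain A \<union> Domain B) l \<subseteq> Domain B"
    proof
      fix h assume "h \<in> enclosing before (Domain A \<union> Domain B) l"
      moreover obtain j where "South j \<in> l" using south[OF l] by blast
      ultimately obtain a where "h \<in> Domain A \<union> Domain B" "a \<in> h" "before (South j) a"
        unfolding enclosing_def by blast
      then show "h \<in> Domain B" using before_South AB by blast
    qed
  qed simp
  have no_crossing: False if l: "l \<in> Domain A \<union> Domain B" "l' \<in> Domain A \<union> Domain B"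
    "a \<in> l" "b \<in> l'" "a' \<in> l" "b' \<in> l'" "before a b" "before b a'" "before a' b'" for l l' a b a' b'
  proof (cases "(l \<in> Domain A \<and> l' \<in> Domain A) \<or> (l \<in> Domain B \<and> l' \<in> Domain B)")
    case True
    moreover have "crossing_free before (Domain A)" "crossing_free before (Domain B)"
      using decorated_matching[OF A] decorated_matching[OF B] by (simp_all add: planar_matching_def)
    ultimately show False using crossing_freeD[OF _ _ _ l(3-8)] l(9) by metis
  next
    case False
    show False
    proof (cases b)
      case (North i)
      then obtain i' where "a = North i'" using before_North l(7) by blast
      then show False using False l(1-4) North BA by blast
    next
      case (South j)
      then obtain j' where "a' = South j'" using before_South l(8) by blast
      then show False using False l(1,2,4,5) South AB by blast
    qed
  qed
  have matching: "planar_matching before (S \<union> T) (Domain A \<union> Domain B)"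
  proof (rule planar_matchingI)
    show "\<Union>(Domain A \<union> Domain B) = S \<union> T"
      unfolding Union_Un_distrib decorated_points[OF A] decorated_points[OF B] ..
    show "card l = 2" if "l \<in> Domain A \<union> Domain B" for l
      using that decorated_line(2)[OF A] decorated_line(2)[OF B] by blast
    show "crossing_free before (Domain A \<union> Domain B)"
      unfolding crossing_free_def using no_crossing by blast
    have same: "l = l'" if l: "l \<in> Domain A" "l' \<in> Domain B" "p \<in> l" "p \<in> l'" for l l' p
    proof (cases p)
      case (North i)
      then show ?thesis using decorated_same_line[OF A l(1) BA l(3,4)] l by simp
    next
      case (South j)
      then show ?thesis using decorated_same_line[OF B AB l(2) l(3,4)] l by simp
    qed
    show "l = l'" if "l \<in> Domain A \<union> Domain B" "l' \<in> Domain A \<union> Domain B" "p \<in> l" "p \<in> l'" for l l' p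
      using that same[of l l' p] same[of l' l p] decorated_same_line[OF A, of l l' p]
        decorated_same_line[OF B, of l l' p] by blast
  qed
  show ?thesis
  proof (rule decoratedI)
    show "planar_matching before (S \<union> T) (Domain (A \<union> B))" using matching by (simp add: Domain_Un_eq)
    have same: "b = b'" if "(l, b) \<in> A" "(l, b') \<in> B" for l b b'
    proof -
      obtain i j where "North i \<in> l" "South j \<in> l" using north[of l] south[of l] \<open>(l, b) \<in> A\<close> \<open>(l, b') \<in> B\<close> by blast
      then show ?thesis using agree that decorated_same_blobs[OF A] by blast
    qed
    show "b = b'" if "(l, b) \<in> A \<union> B" "(l, b') \<in> A \<union> B" for l b b'
      using that same[of l b b'] same[of l b' b] decorated_same_blobs[OF A, of l b b']
        decorated_same_blobs[OF B, of l b b'] by blast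
    show "if card (enclosing before (Domain (A \<union> B)) l) < k then b < d else b = 0"
      if "(l, b) \<in> A \<union> B" for l b
    proof (cases "(l, b) \<in> A")
      case True
      then show ?thesis
        using decorated_blobs[OF A True] eA[OF DomainI[OF True]] by (simp only: Domain_Un_eq)
    next
      case False
      then have lB: "(l, b) \<in> B" using that by simp
      show ?thesis
        using decorated_blobs[OF B lB] eB[OF DomainI[OF lB]] by (simp only: Domain_Un_eq)
    qed
  qed
qed

text \<open>The northern end of the propagating line at southern point \<open>j\<close>; arbitrary if there is
  no such line.\<close>

definition partner :: "diagram \<Rightarrow> nat \<Rightarrow> nat" where
  "partner W j = (THE i. (i, j) \<in> propagating_pairs (Domain W))"

lemma partner_eq:
  assumes "planar_matching r S (Domain W)" "(i, j) \<in> propagating_pairs (Domain W)"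
  shows "partner W j = i"
  unfolding partner_def using assms propagating_pair_unique by (intro the_equality) blast+

lemma half_diagram_partner:
  assumes "half_diagram k d n v W" "j \<in> {1..length v}"
  shows "(partner W j, j) \<in> propagating_pairs (Domain W)"
proof -
  obtain i where "(i, j) \<in> propagating_pairs (Domain W)"
    using assms(2) unfolding half_diagram_souths[OF assms(1), symmetric] by auto
  then show ?thesis using partner_eq[OF half_diagram_matching[OF assms(1)]] by simp
qed

lemma half_diagram_partner_less_iff:
  assumes "half_diagram k d n v W" "i \<in> {1..length v}" "j \<in> {1..length v}"
  shows "partner W i < partner W j \<longleftrightarrow> i < j"
  using propagating_pair_order[OF half_diagram_matching[OF assms(1)]]
    half_diagram_partner[OF assms(1)] assms(2,3) by blast

text \<open>Undoes the renumbering of an upper half: when its \<open>i\<close>-th propagating line is continued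
  by the \<open>i\<close>-th one of \<open>W\<close>, turned upside down, it ends where that line begins in
  \<open>W\<close>.\<close>

definition spread :: "diagram \<Rightarrow> point \<Rightarrow> point" where
  "spread W p = (case p of North i \<Rightarrow> North i | South j \<Rightarrow> South (partner W j))"

lemma spread_simps [simp]:
  "spread W (North i) = North i" "spread W (South j) = South (partner W j)"
  by (simp_all add: spread_def)

text \<open>The propagating lines occur in both parts of the union, with the same ends and the same blobs
  (\<open>spread_halves_agree\<close> below).  The definition is symmetric up to reflection.\<close>

definition glue :: "diagram \<Rightarrow> diagram \<Rightarrow> diagram" where
  "glue U W = relabel (spread W) U \<union> reflect (relabel (spread U) W)"

lemma reflect_Un: "reflect (A \<union> B) = reflect A \<union> reflect B"
  by (simp add: reflect_def relabel_def image_Un)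

lemma reflect_glue: "reflect (glue U W) = glue W U"
  by (simp add: glue_def reflect_Un Un_commute)

lemma decorated_spread:
  assumes U: "half_diagram k d n v U" and W: "half_diagram k d m v W"
  shows "decorated k d before (North ` {1..n} \<union> South ` partner W ` {1..length v}) (relabel (spread W) U)"
proof -
  let ?S = "points n (length v)"
  note less = half_diagram_partner_less_iff[OF W]
  have mono: "before (spread W x) (spread W y) = before x y" if "x \<in> ?S" "y \<in> ?S" for x y
    using that less by (cases x; cases y) (auto simp: points_def)
  have eq: "partner W i = partner W j \<longleftrightarrow> i = j" if "i \<in> {1..length v}" "j \<in> {1..length v}" for i j
    using less[OF that] less[OF that(2,1)] by (metis less_irrefl linorder_neqE_nat)
  have "inj_on (spread W) ?S"
  proof (rule inj_onI)
    fix x y assume "x \<in> ?S" "y \<in> ?S" "spread W x = spread W y"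
    then show "x = y" using eq by (cases x; cases y) (auto simp: points_def)
  qed
  from decorated_relabel[OF half_diagram_decorated[OF U] this, where r' = before, OF mono]
  have "decorated k d before (spread W ` ?S) (relabel (spread W) U)" .
  also have "spread W ` ?S = North ` {1..n} \<union> South ` partner W ` {1..length v}"
    by (simp add: points_def image_Un image_image)
  finally show ?thesis .
qed

text \<open>No line joins two southern points, because each of them ends a propagating line.\<close>

lemma half_diagram_has_north:
  assumes D: "half_diagram k d n v D" and l: "l \<in> Domain D"
  shows "\<exists>i. North i \<in> l"
proof -
  obtain p q where l2: "l = {p, q}" "p \<noteq> q"
    using decorated_line(2)[OF half_diagram_decorated[OF D] l] by (auto simp: card_2_iff)
  show ?thesis
  proof (cases p)
    case (North i)
    then show ?thesis using l2 by auto
  next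
    case (South j)
    then have "j \<in> {1..length v}"
      using decorated_line(1)[OF half_diagram_decorated[OF D] l] l2 by (auto simp: points_def)
    then obtain i where "{North i, South j} \<in> Domain D"
      unfolding half_diagram_souths[OF D, symmetric] by (auto simp: mem_propagating_pairs)
    then have "{North i, South j} = l"
      using decorated_same_line[OF half_diagram_decorated[OF D] _ l, of "{North i, South j}" p] l2 South by simp
    then show ?thesis by auto
  qed
qed

lemma mem_relabel_spread:
  assumes U: "half_diagram k d n v U"
  shows "({North a, South c}, b) \<in> relabel (spread W) U \<longleftrightarrow>
    (\<exists>i\<in>{1..length v}. ({North a, South i}, b) \<in> U \<and> partner W i = c)"
proof
  assume "({North a, South c}, b) \<in> relabel (spread W) U"
  then obtain l where l: "{North a, South c} = spread W ` l" "(l, b) \<in> U" by (elim mem_relabelE)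
  then obtain p q where pq: "p \<in> l" "q \<in> l" "spread W p = North a" "spread W q = South c"
    by (metis (no_types, lifting) imageE insertI1 insert_commute)
  then obtain j where j: "p = North a" "q = South j" "partner W j = c"
    by (cases p; cases q) auto
  have "l \<in> Domain U" using l(2) by auto
  moreover from this have "l = {North a, South j}"
    using mixed_line[OF half_diagram_matching[OF U]] pq j by simp
  ultimately show "\<exists>i\<in>{1..length v}. ({North a, South i}, b) \<in> U \<and> partner W i = c"
    using l(2) j propagating_pair_range(2)[OF half_diagram_matching[OF U], of a j]
    by (auto simp: mem_propagating_pairs)
next
  assume "\<exists>i\<in>{1..length v}. ({North a, South i}, b) \<in> U \<and> partner W i = c"
  then obtain i where "({North a, South i}, b) \<in> U" "partner W i = c" by blast
  then show "({North a, South c}, b) \<in> relabel (spread W) U"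
    using mem_relabelI[of "{North a, South i}" b U "spread W"] by simp
qed

text \<open>Equal labels mean equal numbers of blobs on corresponding propagating lines.\<close>

lemma half_diagram_blobs_agree:
  assumes U: "half_diagram k d n v U" and W: "half_diagram k d m v W"
    and i: "i \<in> {1..length v}" and a: "({North a, South i}, b) \<in> U"
  shows "({North (partner W i), South i}, b) \<in> W"
proof -
  obtain j where j: "i = Suc j" "j < length v" using i by (cases i) auto
  obtain a' b' where a': "({North a', South i}, b') \<in> U" "v ! j = Suc b'"
    using U j unfolding half_diagram_def by blast
  obtain c b'' where c: "({North c, South i}, b'') \<in> W" "v ! j = Suc b''"
    using W j unfolding half_diagram_def by blast
  have "{North a', South i} = {North a, South i}"
    using a a' by (intro decorated_same_line[OF half_diagram_decorated[OF U], of _ _ "South i"]) auto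
  then have "b' = b" using decorated_same_blobs[OF half_diagram_decorated[OF U]] a a' by auto
  moreover have "partner W i = c"
    using c by (intro partner_eq[OF half_diagram_matching[OF W]]) (auto simp: mem_propagating_pairs)
  ultimately show ?thesis using c a' by simp
qed

lemma spread_halves_agree:
  assumes U: "half_diagram k d n v U" and W: "half_diagram k d m v W"
  shows "({North a, South c}, b) \<in> relabel (spread W) U \<longleftrightarrow>
    ({North c, South a}, b) \<in> relabel (spread U) W"
proof -
  have *: "({North c, South a}, b) \<in> relabel (spread U) W"
    if U: "half_diagram k d n v U" and W: "half_diagram k d m v W"
      and ac: "({North a, South c}, b) \<in> relabel (spread W) U" for U W n m a c
  proof -
    obtain i where i: "i \<in> {1..length v}" "({North a, South i}, b) \<in> U" "partner W i = c"
      using ac unfolding mem_relabel_spread[OF U] by blast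
    have "partner U i = a"
      using i(2) by (intro partner_eq[OF half_diagram_matching[OF U]]) (auto simp: mem_propagating_pairs)
    then show ?thesis
      using half_diagram_blobs_agree[OF U W i(1,2)] i unfolding mem_relabel_spread[OF W] by auto
  qed
  show ?thesis using *[OF U W] *[OF W U] by blast
qed

lemma relabel_spread_has_north:
  assumes "half_diagram k d n v U" "l \<in> Domain (relabel (spread W) U)"
  shows "\<exists>i. North i \<in> l"
proof -
  obtain h where h: "h \<in> Domain U" "l = spread W ` h" using assms(2) unfolding Domain_relabel by blast
  then obtain i where "North i \<in> h" using half_diagram_has_north[OF assms(1)] by blast
  then have "spread W (North i) \<in> l" using h by blast
  then show ?thesis by auto
qed

lemma reflected_spread_has_south:
  assumes "half_diagram k d n v U" "l \<in> Domain (reflect (relabel (spread W) U))"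
  shows "\<exists>j. South j \<in> l"
proof -
  obtain h where h: "h \<in> Domain (relabel (spread W) U)" "l = flip ` h"
    using assms(2) unfolding reflect_eq Domain_relabel[of flip] by blast
  then obtain i where "North i \<in> h" using relabel_spread_has_north[OF assms(1)] by blast
  then have "flip (North i) \<in> l" using h by blast
  then show ?thesis by auto
qed

lemma decorated_mixed_agree:
  assumes A: "decorated k d before S A" and B: "decorated k d before T B"
    and agree: "\<And>a c b. ({North a, South c}, b) \<in> A \<longleftrightarrow> ({North a, South c}, b) \<in> B"
    and l: "North i \<in> l" "South j \<in> l"
  shows "(l, b) \<in> A \<longleftrightarrow> (l, b) \<in> B"
proof -
  have "l = {North i, South j}" if "l \<in> Domain A \<or> l \<in> Domain B"
    using that mixed_line[OF decorated_matching[OF A] _ l] mixed_line[OF decorated_matching[OF B] _ l] by blast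
  then show ?thesis using agree by blast
qed

context
  fixes k d n m v U W
  assumes U: "half_diagram k d n v U" and W: "half_diagram k d m v W"
begin

lemma glue_mixed_lines_agree:
  assumes "North i \<in> l" "South j \<in> l"
  shows "(l, b) \<in> relabel (spread W) U \<longleftrightarrow> (l, b) \<in> reflect (relabel (spread U) W)"
  using decorated_spread[OF U W] decorated_reflect[OF decorated_spread[OF W U]]
  by (rule decorated_mixed_agree[OF _ _ _ assms]) (simp_all add: mem_reflect_pair spread_halves_agree[OF U W])

lemma decorated_glued: "decorated k d before (points n m) (glue U W)"
proof -
  let ?S = "North ` {1..n} \<union> South ` partner W ` {1..length v}"
    and ?T = "flip ` (North ` {1..m} \<union> South ` partner U ` {1..length v})"
  have "decorated k d before (?S \<union> ?T) (glue U W)"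
    unfolding glue_def
    using decorated_spread[OF U W] decorated_reflect[OF decorated_spread[OF W U]]
  proof (rule decorated_glue)
    show "\<exists>i. North i \<in> l" if "l \<in> Domain (relabel (spread W) U)" for l
      using relabel_spread_has_north[OF U that] .
    show "\<exists>j. South j \<in> l" if "l \<in> Domain (reflect (relabel (spread U) W))" for l
      using reflected_spread_has_south[OF W that] .
  qed (rule glue_mixed_lines_agree)
  moreover have "partner W ` {1..length v} \<subseteq> {1..m}"
    using propagating_pair_range(1)[OF half_diagram_matching[OF W] half_diagram_partner[OF W]] by blast
  moreover have "partner U ` {1..length v} \<subseteq> {1..n}"
    using propagating_pair_range(1)[OF half_diagram_matching[OF U] half_diagram_partner[OF U]] by blast
  moreover have "?S \<union> ?T = North ` ({1..n} \<union> partner U ` {1..length v}) \<union>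
      South ` ({1..m} \<union> partner W ` {1..length v})"
    by (simp add: image_Un image_image Un_ac)
  ultimately show ?thesis by (simp only: points_def Un_absorb2)
qed

lemma north_part_glued: "north_part (glue U W) = relabel (spread W) U"
proof (intro equalityI subrelI)
  fix l b assume "(l, b) \<in> north_part (glue U W)"
  then obtain i where i: "(l, b) \<in> glue U W" "North i \<in> l" by (auto simp: north_part_def)
  show "(l, b) \<in> relabel (spread W) U"
  proof (cases "(l, b) \<in> relabel (spread W) U")
    case False
    then have r: "(l, b) \<in> reflect (relabel (spread U) W)" using i by (simp add: glue_def)
    then obtain j where "South j \<in> l" using reflected_spread_has_south[OF W] by blast
    then show ?thesis using glue_mixed_lines_agree i(2) r by blast
  qed
next
  fix l b assume l: "(l, b) \<in> relabel (spread W) U"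
  then have "\<exists>i. North i \<in> l" using relabel_spread_has_north[OF U] by blast
  then show "(l, b) \<in> north_part (glue U W)" using l by (simp add: north_part_def glue_def)
qed

lemma souths_glued: "souths (glue U W) = partner W ` {1..length v}"
proof -
  have "(a, c) \<in> propagating_pairs (Domain (glue U W)) \<longleftrightarrow>
    (\<exists>b. ({North a, South c}, b) \<in> relabel (spread W) U)" for a c
  proof -
    have "({North a, South c}, b) \<in> glue U W \<longleftrightarrow> ({North a, South c}, b) \<in> relabel (spread W) U" for b
      using glue_mixed_lines_agree[of a "{North a, South c}" c b] by (simp add: glue_def)
    then show ?thesis by (simp add: mem_propagating_pairs Domain_iff)
  qed
  also have "\<dots> a c \<longleftrightarrow> (\<exists>i\<in>{1..length v}. (a, i) \<in> propagating_pairs (Domain U) \<and> partner W i = c)" for a c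
    unfolding mem_relabel_spread[OF U] mem_propagating_pairs by blast
  finally have pairs: "(a, c) \<in> propagating_pairs (Domain (glue U W)) \<longleftrightarrow>
    (\<exists>i\<in>{1..length v}. (a, i) \<in> propagating_pairs (Domain U) \<and> partner W i = c)" for a c .
  show ?thesis
  proof (intro equalityI subsetI)
    fix c assume "c \<in> souths (glue U W)"
    then show "c \<in> partner W ` {1..length v}" using pairs by auto
  next
    fix c assume "c \<in> partner W ` {1..length v}"
    then obtain i where i: "i \<in> {1..length v}" "c = partner W i" by blast
    then have "(partner U i, c) \<in> propagating_pairs (Domain (glue U W))"
      using pairs half_diagram_partner[OF U] by blast
    then show "c \<in> souths (glue U W)" by force
  qed
qed

text \<open>The lines of \<open>W\<close> are ordered alike at both ends, so numbering their northern ends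
  consecutively restores the numbers of their southern ends.\<close>

lemma rank_partner:
  assumes i: "i \<in> {1..length v}"
  shows "rank (partner W ` {1..length v}) (partner W i) = i"
proof -
  note less = half_diagram_partner_less_iff[OF W]
  have "{c \<in> partner W ` {1..length v}. c \<le> partner W i} = partner W ` {1..i}"
    using less i by (auto simp: not_less[symmetric])
  moreover have "inj_on (partner W) {1..i}"
  proof (rule inj_onI)
    fix x y assume "x \<in> {1..i}" "y \<in> {1..i}" "partner W x = partner W y"
    then show "x = y" using less[of x y] less[of y x] i by auto
  qed
  ultimately show ?thesis by (simp add: rank_def card_image)
qed

lemma upper_half_glued: "upper_half (glue U W) = U"
  unfolding upper_half_eq north_part_glued souths_glued relabel_relabel
proof (rule relabel_ident)
  fix p assume "p \<in> \<Union>(Domain U)"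
  then have "p \<in> points n (length v)" using decorated_points[OF half_diagram_decorated[OF U]] by simp
  then show "(straighten (partner W ` {1..length v}) \<circ> spread W) p = p"
    using rank_partner by (auto simp: points_def)
qed

end

text \<open>The propagating line that ended at \<open>South c\<close> has the same rank in both halves, so its
  continuation in the lower half leads back to \<open>c\<close>.\<close>

lemma relabel_spread_upper_half:
  assumes dec: "decorated k d before (points n m) D"
  shows "relabel (spread (upper_half (reflect D))) (upper_half D) = north_part D"
  unfolding upper_half_eq[of D] relabel_relabel
proof (rule relabel_ident)
  let ?W = "upper_half (reflect D)"
  obtain v where W: "half_diagram k d m v ?W" using cut_halves[OF dec] by blast
  fix p assume "p \<in> \<Union>(Domain (north_part D))"
  then have p: "p \<in> North ` {1..n} \<union> South ` souths D" using north_part_points[OF dec] by simp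
  have partner: "partner ?W (rank (souths D) c) = c" if c: "c \<in> souths D" for c
  proof -
    obtain a where a: "(a, c) \<in> propagating_pairs (Domain D)" using c by auto
    then obtain b where "({North a, South c}, b) \<in> D" by (auto simp: mem_propagating_pairs)
    then have "({North c, South a}, b) \<in> reflect D" by (simp add: mem_reflect_pair)
    from upper_half_propagating[OF this]
    have "(c, rank (souths D) c) \<in> propagating_pairs (Domain ?W)"
      unfolding propagating_ranks_agree[OF dec a] mem_propagating_pairs by blast
    then show ?thesis by (rule partner_eq[OF half_diagram_matching[OF W]])
  qed
  show "(spread ?W \<circ> straighten (souths D)) p = p"
  proof (cases p)
    case (South c)
    then have "c \<in> souths D" using p by blast
    then show ?thesis using South partner by simp
  qed simp
qed

lemma glue_halves:
  assumes dec: "decorated k d before (points n m) D"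
  shows "glue (upper_half D) (upper_half (reflect D)) = D"
proof -
  have "decorated k d before (points m n) (reflect D)" using dec by (simp add: decorated_reflect_points)
  from relabel_spread_upper_half[OF this]
  have "relabel (spread (upper_half D)) (upper_half (reflect D)) = north_part (reflect D)" by simp
  then have eq: "glue (upper_half D) (upper_half (reflect D)) = north_part D \<union> {(l, b) \<in> D. \<exists>j. South j \<in> l}"
    unfolding glue_def relabel_spread_upper_half[OF dec] by (simp add: reflect_north_part_reflect)
  have "(\<exists>i. North i \<in> l) \<or> (\<exists>j. South j \<in> l)" if "(l, b) \<in> D" for l b
  proof -
    have "l \<in> Domain D" using that by auto
    then obtain p where "p \<in> l" using decorated_line(2)[OF dec] by (fastforce simp: card_2_iff)
    then show ?thesis by (cases p) auto
  qed
  then show ?thesis unfolding eq north_part_def by auto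
qed

text \<open>The label of a diagram is a function of its upper half, and \<open>glue\<close> is inverse to
  cutting on both sides.\<close>

theorem cut_bij_betw:
  "\<exists>\<beta>. bij_betw \<beta> (contour_diagrams k d n m)
         (SIGMA v : verts (contour_tree k d). half_diagrams k d n v \<times> half_diagrams k d m v) \<and>
       (\<forall>D\<in>contour_diagrams k d n m. snd (\<beta> D) = (upper_half D, upper_half (reflect D)))"
proof -
  let ?C = "contour_diagrams k d n m"
  let ?R = "SIGMA v : verts (contour_tree k d). half_diagrams k d n v \<times> half_diagrams k d m v"
  define label where "label D = (SOME v. half_diagram k d n v (upper_half D))" for D
  let ?b = "\<lambda>D. (label D, upper_half D, upper_half (reflect D))"
  have label: "label D = v" if "half_diagram k d n v (upper_half D)" for v D
    unfolding label_def using that half_diagram_label_unique by (intro some_equality) blast+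
  have "bij_betw ?b ?C ?R"
  proof (rule bij_betw_byWitness[where f' = "\<lambda>(v, U, W). glue U W"])
    show "\<forall>D\<in>?C. (\<lambda>(v, U, W). glue U W) (?b D) = D"
      using glue_halves by (simp add: contour_diagrams_iff)
    show "\<forall>x\<in>?R. ?b ((\<lambda>(v, U, W). glue U W) x) = x"
    proof
      fix x assume "x \<in> ?R"
      then obtain v U W where x: "x = (v, U, W)"
        and U: "half_diagram k d n v U" and W: "half_diagram k d m v W"
        by (auto simp: half_diagrams_iff)
      have "upper_half (glue U W) = U" by (rule upper_half_glued[OF U W])
      moreover have "upper_half (reflect (glue U W)) = W"
        unfolding reflect_glue by (rule upper_half_glued[OF W U])
      ultimately show "?b ((\<lambda>(v, U, W). glue U W) x) = x"
        using label[of v "glue U W"] U by (simp add: x)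
    qed
    show "?b ` ?C \<subseteq> ?R"
    proof (rule image_subsetI)
      fix D assume "D \<in> ?C"
      then have "decorated k d before (points n m) D" by (simp add: contour_diagrams_iff)
      then obtain v where v: "half_diagram k d n v (upper_half D)" "half_diagram k d m v (upper_half (reflect D))"
        by (rule cut_halves)
      then show "?b D \<in> ?R"
        using label half_diagram_label_in_verts by (simp add: half_diagrams_iff)
    qed
    show "(\<lambda>(v, U, W). glue U W) ` ?R \<subseteq> ?C"
      using decorated_glued by (auto simp: half_diagrams_iff contour_diagrams_iff)
  qed
  then show ?thesis by (intro exI[of _ ?b]) simp
qed

theorem proposition6p8:
  fixes k d :: nat
  assumes "d \<ge> 1"
  shows "pascal_array (contour_tree k d) [] (half_diagrams k d) \<and>
    underlies (contour_tree k d) [] (half_diagrams k d) (\<lambda>n. contour_diagrams k d n n) \<and>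
    pascal_array (contour_tree k d) [] (reflected_lower_half_diagrams k d) \<and>
    (\<forall>n. \<exists>\<beta>.
       bij_betw \<beta> (contour_diagrams k d n n)
         (SIGMA v : verts (contour_tree k d).
            half_diagrams k d n v \<times> reflected_lower_half_diagrams k d n v) \<and>
       (\<forall>D\<in>contour_diagrams k d n n. snd (\<beta> D) = (upper_half D, reflect (lower_half D))))"
proof -
  have "underlies (contour_tree k d) [] (half_diagrams k d) (\<lambda>n. contour_diagrams k d n n)"
    unfolding underlies_def
    using pascal_array_half_diagrams[of k d] cut_bij_betw[of k d] by blast
  then show ?thesis
    unfolding reflected_lower_half_diagrams_eq reflect_lower_half
    using pascal_array_half_diagrams cut_bij_betw by blast
qed

end
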